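(* Let $F$ be the distribution function of a non-negative random variable $W$ with $\nu=\mathbb{E}[W^2]/\mathbb{E}[W]=1$, and suppose there exist $\tau\in(3,4)$ and a constant $0<c_F<\infty$ such that $$\lim_{x\to\infty}x^{\tau-1}[1-F(x)]=c_F.$$ Let $w_j=[1-F]^{-1}(j/n)$ for $j\in[n]$, and let $\tilde{\boldsymbol w}=(\tilde w_j)_{j\in[n]}$ with $\tilde w_j=(1+\varepsilon_n)w_j$, where $(\varepsilon_n)_{n\ge1}$ is a fixed real sequence such that $|\varepsilon_n|\le \Lambda n^{-(\tau-3)/(\tau-1)}$ for some $\Lambda>0$. Then there exists a constant $b=b(\Lambda)>0$ such that for all $\omega>1$ and for $n$ sufficiently large, the random graph $\mathrm{NR}_n(\tilde{\boldsymbol w})$ satisfies $$\mathbb{P}\Big(\omega^{-1}n^{(\tau-2)/(\tau-1)}\le |\mathcal{C}_{\max}|\le \omega n^{(\tau-2)/(\tau-1)}\Big)\ge 1-\frac{b}{\omega}.$$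
   Context: $[n]=\{1,\dots,n\}$. The generalized inverse is $[1-F]^{-1}(u)=\inf\{s: 1-F(s)\le u\}$ for $u\in(0,1)$, with the convention $[1-F]^{-1}(1)=0$. Norros--Reittu random graph: for non-negative vertex weights $\boldsymbol v=(v_j)_{j\in[n]}$ with total weight $L_n=\sum_{j=1}^n v_j>0$, $\mathrm{NR}_n(\boldsymbol v)$ is the random graph on vertex set $[n]$ in which the edges $ij$, $1\le i<j\le n$, are present independently, edge $ij$ being present with probability $1-e^{-v_iv_j/L_n}$. For $v\in[n]$, $\mathcal{C}(v)$ is the set of vertices connected to $v$ by a path of present edges (including $v$ itself), and $|\mathcal{C}_{\max}|=\max_{v\in[n]}|\mathcal{C}(v)|$. The distribution function $F$ is fixed, so constants may depend on $F$. *)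

theory Defs
  imports "HOL-Probability.Probability"
begin

definition gen_inverse :: "(real \<Rightarrow> real) \<Rightarrow> real \<Rightarrow> real" where
  "gen_inverse F u = (if u = 1 then 0 else Inf {s. 1 - F s \<le> u})"

definition weight :: "(real \<Rightarrow> real) \<Rightarrow> nat \<Rightarrow> nat \<Rightarrow> real" where
  "weight F n j = gen_inverse F (real j / real n)"

definition total_weight :: "nat \<Rightarrow> (nat \<Rightarrow> real) \<Rightarrow> real" where
  "total_weight n v = (\<Sum>j = 1..n. v j)"

(* The undirected edge ij with i < j is represented by the pair (i, j) only.  The definition is
   meant for non-negative weights with positive total weight; otherwise the edge probability may
   be negative (bernoulli_pmf then truncates it to 0) or involve a division by 0. *)
definition NR :: "nat \<Rightarrow> (nat \<Rightarrow> real) \<Rightarrow> (nat \<times> nat) set pmf" where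
  "NR n v =
     map_pmf (\<lambda>present. {e. present e})
       (Pi_pmf {(i, j). 1 \<le> i \<and> i < j \<and> j \<le> n} False
         (\<lambda>(i, j). bernoulli_pmf (1 - exp (- (v i * v j / total_weight n v)))))"

(* The edge set is symmetrised, so paths may traverse edges in both directions.  All edges of a
   graph in the support of NR n v join vertices in {1..n}; hence the cluster of any
   vertex in {1..n} is contained in {1..n}. *)
definition cluster :: "(nat \<times> nat) set \<Rightarrow> nat \<Rightarrow> nat set" where
  "cluster E x = {y. (x, y) \<in> (E \<union> E\<inverse>)\<^sup>*}"

definition max_cluster_size :: "nat \<Rightarrow> (nat \<times> nat) set \<Rightarrow> nat" where
  "max_cluster_size n E = Max ((\<lambda>x. card (cluster E x)) ` {1..n})"

end

(* Put a = 1/(tau-1), so that the heaviest weights are of order n^a, the critical window has width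
   x = n^(2a-1), and the claimed order of the largest cluster is n^(1-a).

   Exploring clusters vertex by vertex gives a recursion: for an active vertex a, its neighbours
   among the unexplored vertices are independent of all edges not incident to a.  Hence any
   function that is superharmonic for the exploration bounds expectations over clusters.

   Deleting the R heaviest vertices, R a large constant depending on Lambda, removes from
   nu_n = sum w^2 / sum w an amount of order R^(1-2a) x, so what is left is subcritical with margin
   at least x, uniformly in epsilon_n.  A linear superharmonic function then bounds expected cluster
   sizes, and Markov's inequality gives the upper bound: the R hubs together reach O(n^a / x) =
   O(n^(1-a)) vertices in mean, and the clusters avoiding the hubs have sum of squares O(n/x) in mean.

   For the lower bound, explore the cluster C of vertex 1 without using the other hubs.  With
   g(v) = w_v + delta, s = sqrt omega * n^(-a) and delta of order (1 + eta omega + sqrt omega) x, the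
   function exp(-s g(active) - s delta #explored) is superharmonic as long as the explored vertices
   have used up at most d = eta omega x of sum w g / L.  So C is smaller than n^(1-a)/omega with
   probability at most exp(O(1) - const sqrt omega), up to the event that the budget d is exceeded,
   which by the first-moment bound has probability O(x/d). *)

theory Submission
  imports Defs
begin

section \<open>Reachable sets and peeling\<close>

definition reach :: "('a \<times> 'a) set \<Rightarrow> 'a set \<Rightarrow> 'a set \<Rightarrow> 'a set" where
  "reach E A U = ((E \<union> E\<inverse>) \<inter> (UNIV \<times> U))\<^sup>* `` A"

definition nbrs :: "('a \<times> 'a) set \<Rightarrow> 'a \<Rightarrow> 'a set \<Rightarrow> 'a set" where
  "nbrs E a U = {v \<in> U. (a, v) \<in> E \<union> E\<inverse>}"

lemma reach_start: "A \<subseteq> reach E A U"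
  by (auto simp: reach_def)

lemma reach_step:
  assumes "z \<in> reach E A U" "(z, y) \<in> E \<union> E\<inverse>" "y \<in> U"
  shows "y \<in> reach E A U"
  using assms unfolding reach_def by (auto intro: rtrancl_into_rtrancl)

lemma reach_least:
  assumes "A \<subseteq> S" "\<And>z y. z \<in> S \<Longrightarrow> (z, y) \<in> E \<union> E\<inverse> \<Longrightarrow> y \<in> U \<Longrightarrow> y \<in> S"
  shows "reach E A U \<subseteq> S"
proof
  fix y assume "y \<in> reach E A U"
  then obtain x where "x \<in> A" "(x, y) \<in> ((E \<union> E\<inverse>) \<inter> (UNIV \<times> U))\<^sup>*"
    by (auto simp: reach_def)
  from this(2,1) show "y \<in> S"
  proof (induction rule: rtrancl_induct)
    case base
    then show ?case using assms(1) by blast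
  next
    case (step y z)
    then show ?case using assms(2) by blast
  qed
qed

lemma reach_subset: "reach E A U \<subseteq> A \<union> U"
  by (rule reach_least) auto

lemma reach_empty [simp]: "reach E {} U = {}"
  by (simp add: reach_def)

lemma finite_reach: "finite A \<Longrightarrow> finite U \<Longrightarrow> finite (reach E A U)"
  using reach_subset by (metis finite_Un finite_subset)

lemma nbrs_subset: "nbrs E a U \<subseteq> U"
  by (auto simp: nbrs_def)

text \<open>One deterministic exploration step. Once the neighbours of \<open>a\<close> in
  \<open>U\<close> have been made active, no edge leads from \<open>a\<close> into what remains of
  \<open>U\<close>, and \<open>a\<close> itself cannot be entered since it is not in
  \<open>U\<close>. Hence \<open>a\<close> can be set aside for good.\<close>

lemma reach_peel:
  assumes "a \<in> A" "a \<notin> U"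
  shows "reach E A U = insert a (reach E (A - {a} \<union> nbrs E a U) (U - nbrs E a U))"
    (is "_ = insert a (reach E ?A' ?U')")
proof
  show "reach E A U \<subseteq> insert a (reach E ?A' ?U')"
  proof (rule reach_least)
    show "A \<subseteq> insert a (reach E ?A' ?U')"
      using reach_start[of ?A' E ?U'] by auto
  next
    fix z y
    assume z: "z \<in> insert a (reach E ?A' ?U')" and zy: "(z, y) \<in> E \<union> E\<inverse>" and y: "y \<in> U"
    show "y \<in> insert a (reach E ?A' ?U')"
    proof (cases "y \<in> nbrs E a U")
      case True
      then show ?thesis using reach_start[of ?A' E ?U'] by blast
    next
      case False
      with zy y have "z \<noteq> a" by (auto simp: nbrs_def)
      with z False y zy show ?thesis by (auto intro!: reach_step[of z])
    qed
  qed
next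
  have "?A' \<subseteq> reach E A U"
  proof -
    have "v \<in> reach E A U" if "v \<in> nbrs E a U" for v
      using that reach_step[of a E A U v] reach_start[of A E U] assms(1) by (auto simp: nbrs_def)
    then show ?thesis using reach_start[of A E U] by blast
  qed
  then have "reach E ?A' ?U' \<subseteq> reach E A U"
    by (rule reach_least) (use reach_step[of _ E A U] in blast)
  then show "insert a (reach E ?A' ?U') \<subseteq> reach E A U"
    using assms(1) reach_start[of A E U] by blast
qed

text \<open>Only edges from \<open>A\<close> or \<open>U\<close> into \<open>U\<close> are ever
  used. This allows the edges at an explored vertex to be ignored afterwards.\<close>

lemma reach_cong:
  assumes "\<And>z y. z \<in> A \<union> U \<Longrightarrow> y \<in> U \<Longrightarrow> (z, y) \<in> E \<union> E\<inverse> \<longleftrightarrow> (z, y) \<in> E' \<union> E'\<inverse>"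
  shows "reach E A U = reach E' A U"
proof -
  have *: "reach E A U \<subseteq> reach E' A U"
    if "\<And>z y. z \<in> A \<union> U \<Longrightarrow> y \<in> U \<Longrightarrow> (z, y) \<in> E \<union> E\<inverse> \<longleftrightarrow> (z, y) \<in> E' \<union> E'\<inverse>" for E E'
    using that reach_start[of A E' U] reach_subset[of E' A U]
    by (intro reach_least) (meson reach_step subsetD)+
  show ?thesis using *[of E E'] *[of E' E] assms by blast
qed

lemma reach_subset_cluster: "reach E {x} U \<subseteq> cluster E x"
  by (rule reach_least) (auto simp: cluster_def intro: rtrancl_into_rtrancl)

lemma cluster_self: "x \<in> cluster E x"
  by (simp add: cluster_def)

lemma cluster_subset:
  assumes "S \<subseteq> S'" "x \<in> S'" "E \<subseteq> S \<times> S"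
  shows "cluster E x \<subseteq> S'"
proof
  fix y assume "y \<in> cluster E x"
  then have "(x, y) \<in> (E \<union> E\<inverse>)\<^sup>*" by (simp add: cluster_def)
  then show "y \<in> S'"
    by (induction rule: rtrancl_induct) (use assms in auto)
qed

text \<open>A cluster meeting the hub set \<open>H\<close> can be explored from \<open>H\<close>, by
  reversing a path to a hub. A cluster avoiding \<open>H\<close> never uses a hub, so deleting the
  hubs does not shrink it.\<close>

lemma cluster_subset_reach:
  assumes E: "E \<subseteq> V \<times> V" and x: "x \<in> V" and H: "H \<subseteq> V"
  shows "cluster E x \<subseteq> reach E H (V - H) \<or> x \<in> V - H \<and> cluster E x \<subseteq> reach E {x} (V - H - {x})"
proof (cases "cluster E x \<inter> H = {}")
  case True
  have "y \<in> reach E {x} (V - H - {x})" if "(x, y) \<in> (E \<union> E\<inverse>)\<^sup>*" for y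
    using that
  proof (induction rule: rtrancl_induct)
    case base
    then show ?case using reach_start by fastforce
  next
    case (step y z)
    have "z \<in> cluster E x"
      using step.hyps by (auto simp: cluster_def intro: rtrancl_into_rtrancl)
    moreover have "z \<in> V" using step.hyps(2) E by auto
    ultimately have "z = x \<or> z \<in> V - H - {x}" using True by blast
    then show ?case
      using reach_start[of "{x}" E "V - H - {x}"] reach_step[OF step.IH step.hyps(2)] by blast
  qed
  moreover have "x \<notin> H" using True cluster_self by fastforce
  ultimately show ?thesis using x by (auto simp: cluster_def)
next
  case False
  then obtain h where h: "h \<in> H" "(x, h) \<in> (E \<union> E\<inverse>)\<^sup>*" by (auto simp: cluster_def)
  have sym: "sym ((E \<union> E\<inverse>)\<^sup>*)" by (intro sym_rtrancl) (auto simp: sym_def)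
  have "y \<in> reach E H (V - H)" if "(h, y) \<in> (E \<union> E\<inverse>)\<^sup>*" for y
    using that
  proof (induction rule: rtrancl_induct)
    case base
    then show ?case using reach_start h(1) by fastforce
  next
    case (step y z)
    have "z \<in> V" using step.hyps(2) E by auto
    then show ?case
      using reach_start[of H E "V - H"] reach_step[OF step.IH step.hyps(2)] by blast
  qed
  moreover have "(h, y) \<in> (E \<union> E\<inverse>)\<^sup>*" if "y \<in> cluster E x" for y
    using that symD[OF sym h(2)] by (auto simp: cluster_def)
  ultimately show ?thesis by blast
qed

section \<open>Exploration of Norros--Reittu graphs\<close>

definition random_set :: "'e set \<Rightarrow> ('e \<Rightarrow> real) \<Rightarrow> 'e set pmf" where
  "random_set I p = map_pmf (\<lambda>present. {e. present e}) (Pi_pmf I False (\<lambda>e. bernoulli_pmf (p e)))"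

lemma random_set_subset:
  assumes "finite I" "E \<in> set_pmf (random_set I p)"
  shows "E \<subseteq> I"
  using assms set_Pi_pmf_subset[OF assms(1), of False "\<lambda>e. bernoulli_pmf (p e)"]
  by (auto simp: random_set_def)

lemma finite_set_pmf_random_set:
  assumes "finite I"
  shows "finite (set_pmf (random_set I p))"
proof (rule finite_subset)
  show "set_pmf (random_set I p) \<subseteq> Pow I"
    using random_set_subset[OF assms] by auto
qed (use assms in simp)

lemma random_set_split:
  assumes "finite I"
  shows "map_pmf (\<lambda>E. (E \<inter> J, E - J)) (random_set I p) =
         pair_pmf (random_set (I \<inter> J) p) (random_set (I - J) p)"
proof -
  let ?P = "\<lambda>I. Pi_pmf I False (\<lambda>e. bernoulli_pmf (p e))"
  have *: "?P I = map_pmf (\<lambda>(f, g) x. if x \<in> I \<inter> J then f x else g x) (pair_pmf (?P (I \<inter> J)) (?P (I - J)))"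
    using assms by (subst Pi_pmf_union[symmetric]) (auto simp: Int_Diff_Un)
  have fg: "(f x \<longrightarrow> x \<in> I \<inter> J) \<and> (g x \<longrightarrow> x \<in> I - J)"
    if "f \<in> set_pmf (?P (I \<inter> J))" "g \<in> set_pmf (?P (I - J))" for f g x
    using that assms set_Pi_pmf_subset[of "I \<inter> J" False] set_Pi_pmf_subset[of "I - J" False] by blast
  have "map_pmf (\<lambda>E. (E \<inter> J, E - J)) (random_set I p) =
    map_pmf (\<lambda>(f, g). ({e. f e}, {e. g e})) (pair_pmf (?P (I \<inter> J)) (?P (I - J)))"
    unfolding random_set_def * pmf.map_comp
    by (rule map_pmf_cong[OF refl]) (auto dest: fg)
  also have "\<dots> = pair_pmf (random_set (I \<inter> J) p) (random_set (I - J) p)"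
    by (simp add: random_set_def map_pair)
  finally show ?thesis .
qed

lemma expectation_pair_pmf_finite:
  fixes K :: "'a \<Rightarrow> 'b \<Rightarrow> real"
  assumes "finite (set_pmf P)" "finite (set_pmf Q)"
  shows "measure_pmf.expectation (pair_pmf P Q) (\<lambda>(x, y). K x y) =
         measure_pmf.expectation P (\<lambda>x. measure_pmf.expectation Q (K x))"
proof -
  have "pair_pmf P Q = bind_pmf P (\<lambda>x. map_pmf (Pair x) Q)"
    by (simp add: pair_pmf_def map_pmf_def)
  then have "measure_pmf.expectation (pair_pmf P Q) (\<lambda>(x, y). K x y) =
    (\<Sum>a\<in>set_pmf P. pmf P a *\<^sub>R measure_pmf.expectation (map_pmf (Pair a) Q) (\<lambda>(x, y). K x y))"
    using assms by (simp add: pmf_expectation_bind[of "set_pmf P"])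
  also have "\<dots> = measure_pmf.expectation P (\<lambda>x. measure_pmf.expectation Q (K x))"
    using assms by (subst integral_measure_pmf[of "set_pmf P"]) auto
  finally show ?thesis .
qed

text \<open>The restrictions to \<open>J\<close> and to its complement are independent, so the
  second may come from a fresh copy. Both copies carry the full law on \<open>I\<close>, which lets
  every step of an exploration be written with the same measure.\<close>

lemma random_set_expectation_split:
  fixes K :: "'e set \<Rightarrow> 'e set \<Rightarrow> real"
  assumes "finite I"
  shows "measure_pmf.expectation (random_set I p) (\<lambda>E. K (E \<inter> J) (E - J)) =
         measure_pmf.expectation (random_set I p)
           (\<lambda>E. measure_pmf.expectation (random_set I p) (\<lambda>E'. K (E \<inter> J) (E' - J)))"
proof -
  let ?R = "random_set I p"
  have fst: "map_pmf (\<lambda>E. E \<inter> J) ?R = random_set (I \<inter> J) p"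
    using arg_cong[OF random_set_split[OF assms, of J p], of "map_pmf fst"]
    by (simp add: pmf.map_comp o_def map_fst_pair_pmf)
  have snd: "map_pmf (\<lambda>E. E - J) ?R = random_set (I - J) p"
    using arg_cong[OF random_set_split[OF assms, of J p], of "map_pmf snd"]
    by (simp add: pmf.map_comp o_def map_snd_pair_pmf)
  have "measure_pmf.expectation ?R (\<lambda>E. K (E \<inter> J) (E - J)) =
    measure_pmf.expectation (map_pmf (\<lambda>E. (E \<inter> J, E - J)) ?R) (\<lambda>(x, y). K x y)"
    by simp
  also have "\<dots> = measure_pmf.expectation (random_set (I \<inter> J) p)
      (\<lambda>x. measure_pmf.expectation (random_set (I - J) p) (K x))"
    unfolding random_set_split[OF assms]
    by (rule expectation_pair_pmf_finite) (use assms in \<open>auto intro!: finite_set_pmf_random_set\<close>)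
  also have "\<dots> = measure_pmf.expectation ?R
      (\<lambda>E. measure_pmf.expectation ?R (\<lambda>E'. K (E \<inter> J) (E' - J)))"
    by (simp flip: fst snd)
  finally show ?thesis .
qed

lemma random_set_expectation_prod:
  fixes x :: "'u \<Rightarrow> real"
  assumes I: "finite I" and U: "finite U" "inj_on ed U" "ed ` U \<subseteq> I"
    and p: "\<And>u. u \<in> U \<Longrightarrow> p (ed u) \<in> {0..1}" and x: "\<And>u. u \<in> U \<Longrightarrow> 0 \<le> x u"
  shows "measure_pmf.expectation (random_set I p) (\<lambda>E. \<Prod>u\<in>U. if ed u \<in> E then x u else 1) =
         (\<Prod>u\<in>U. 1 - p (ed u) * (1 - x u))"
proof -
  \<comment> \<open>The weights \<open>x\<close> are moved to the coordinates \<open>ed u\<close>,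
    and every other coordinate gets weight 1, so that the product over \<open>U\<close> becomes a
    product over all of \<open>I\<close>.\<close>
  define f where "f e b = (if e \<in> ed ` U \<and> b then x (the_inv_into U ed e) else 1)" for e b
  have f_ed: "f (ed u) b = (if b then x u else 1)" if "u \<in> U" for u b
    using that by (auto simp: f_def the_inv_into_f_f[OF U(2)])
  have reindex: "(\<Prod>e\<in>I. g e) = (\<Prod>u\<in>U. g (ed u))" if "\<And>e. e \<notin> ed ` U \<Longrightarrow> g e = 1" for g :: "_ \<Rightarrow> real"
  proof -
    have "(\<Prod>e\<in>I. g e) = (\<Prod>e\<in>ed ` U. g e)"
      using U(3) that I by (intro prod.mono_neutral_right) auto
    also have "\<dots> = (\<Prod>u\<in>U. g (ed u))"
      using U(2) by (simp add: prod.reindex)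
    finally show ?thesis .
  qed
  have "measure_pmf.expectation (random_set I p) (\<lambda>E. \<Prod>u\<in>U. if ed u \<in> E then x u else 1) =
    measure_pmf.expectation (Pi_pmf I False (\<lambda>e. bernoulli_pmf (p e))) (\<lambda>y. \<Prod>e\<in>I. f e (y e))"
    unfolding random_set_def integral_map_pmf
    by (intro Bochner_Integration.integral_cong refl)
       (subst reindex, auto simp: f_def the_inv_into_f_f[OF U(2)] intro!: prod.cong)
  also have "\<dots> = (\<Prod>e\<in>I. measure_pmf.expectation (bernoulli_pmf (p e)) (f e))"
  proof (rule expectation_prod_Pi_pmf[OF I])
    show "f e b \<ge> 0" if "e \<in> I" for e b
      using x by (auto simp: f_def the_inv_into_f_f[OF U(2)])
  qed (auto intro: integrable_measure_pmf_finite)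
  also have "\<dots> = (\<Prod>u\<in>U. measure_pmf.expectation (bernoulli_pmf (p (ed u))) (f (ed u)))"
    by (rule reindex) (simp add: f_def [abs_def])
  also have "\<dots> = (\<Prod>u\<in>U. 1 - p (ed u) * (1 - x u))"
  proof (rule prod.cong[OF refl])
    fix u assume u: "u \<in> U"
    then show "measure_pmf.expectation (bernoulli_pmf (p (ed u))) (f (ed u)) = 1 - p (ed u) * (1 - x u)"
      using p[OF u] by (simp add: f_ed algebra_simps)
  qed
  finally show ?thesis .
qed

lemma random_set_prob_mem:
  assumes "finite I" "e \<in> I" "p e \<in> {0..1}"
  shows "measure_pmf.expectation (random_set I p) (\<lambda>E. if e \<in> E then 1 else 0 :: real) = p e"
proof -
  \<comment> \<open>With weight 0 at the single element \<open>e\<close>, the product formula gives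
    the probability that \<open>e\<close> is absent.\<close>
  have "measure_pmf.expectation (random_set I p) (\<lambda>E. \<Prod>u\<in>{e}. if u \<in> E then 0 else 1) =
      (\<Prod>u\<in>{e}. 1 - p u * (1 - 0))"
    using assms by (intro random_set_expectation_prod[where ed = "\<lambda>u. u"]) auto
  then have "measure_pmf.expectation (random_set I p) (\<lambda>E. if e \<in> E then 0 else 1 :: real) = 1 - p e"
    by simp
  moreover have "measure_pmf.expectation (random_set I p) (\<lambda>E. if e \<in> E then 1 else 0 :: real) =
      measure_pmf.expectation (random_set I p) (\<lambda>E. 1 - (if e \<in> E then 0 else 1 :: real))"
    by (intro Bochner_Integration.integral_cong) auto
  moreover have "\<dots> = 1 - measure_pmf.expectation (random_set I p) (\<lambda>E. if e \<in> E then 0 else 1 :: real)"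
    using finite_set_pmf_random_set[OF assms(1)]
    by (subst Bochner_Integration.integral_diff) (auto simp: integrable_measure_pmf_finite)
  ultimately show ?thesis by simp
qed

section \<open>One exploration step in the Norros--Reittu graph\<close>

locale norros_reittu =
  fixes n :: nat and v :: "nat \<Rightarrow> real"
  assumes v_nonneg: "i \<in> {1..n} \<Longrightarrow> 0 \<le> v i"
    and total_pos: "0 < total_weight n v"
begin

abbreviation L :: real where "L \<equiv> total_weight n v"

definition edges :: "(nat \<times> nat) set" where
  "edges = {(i, j). 1 \<le> i \<and> i < j \<and> j \<le> n}"

definition edge_prob :: "nat \<Rightarrow> nat \<Rightarrow> real" where
  "edge_prob i j = 1 - exp (- (v i * v j / L))"

lemma finite_edges: "finite edges"
  by (rule finite_subset[of _ "{1..n} \<times> {1..n}"]) (auto simp: edges_def)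

lemma NR_eq: "NR n v = random_set edges (\<lambda>(i, j). edge_prob i j)"
  unfolding NR_def random_set_def edges_def edge_prob_def by (simp add: case_prod_unfold)

lemma NR_subset: "E \<in> set_pmf (NR n v) \<Longrightarrow> E \<subseteq> edges"
  unfolding NR_eq using finite_edges by (rule random_set_subset)

lemma finite_set_pmf_NR: "finite (set_pmf (NR n v))"
  unfolding NR_eq using finite_edges by (rule finite_set_pmf_random_set)

lemma integrable_NR [simp]: "integrable (measure_pmf (NR n v)) (f :: _ \<Rightarrow> real)"
  by (rule integrable_measure_pmf_finite[OF finite_set_pmf_NR])

lemma expectation_NR_mono:
  fixes f g :: "_ \<Rightarrow> real"
  assumes "\<And>E. E \<subseteq> edges \<Longrightarrow> f E \<le> g E"
  shows "measure_pmf.expectation (NR n v) f \<le> measure_pmf.expectation (NR n v) g"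
  using NR_subset assms by (intro integral_mono_AE) (auto intro!: AE_pmfI)

lemma expectation_NR_cong:
  fixes f g :: "_ \<Rightarrow> real"
  assumes "\<And>E. E \<subseteq> edges \<Longrightarrow> f E = g E"
  shows "measure_pmf.expectation (NR n v) f = measure_pmf.expectation (NR n v) g"
  using expectation_NR_mono[of f g] expectation_NR_mono[of g f] assms by force

lemma edge_prob_bounds:
  assumes "i \<in> {1..n}" "j \<in> {1..n}"
  shows "0 \<le> edge_prob i j" "edge_prob i j \<le> 1" "edge_prob i j \<le> v i * v j / L"
proof -
  have "0 \<le> v i * v j / L"
    using assms v_nonneg total_pos by auto
  then show "0 \<le> edge_prob i j" "edge_prob i j \<le> 1" "edge_prob i j \<le> v i * v j / L"
    using exp_ge_add_one_self[of "- (v i * v j / L)"] by (auto simp: edge_prob_def)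
qed

definition pair_edge :: "nat \<Rightarrow> nat \<Rightarrow> nat \<times> nat" where
  "pair_edge a u = (min a u, max a u)"

lemma inj_pair_edge: "inj_on (pair_edge a) U"
  by (auto simp: inj_on_def pair_edge_def min_def max_def split: if_splits)

lemma pair_edge_in: "a \<in> {1..n} \<Longrightarrow> U \<subseteq> {1..n} \<Longrightarrow> a \<notin> U \<Longrightarrow> pair_edge a ` U \<subseteq> edges"
proof (rule image_subsetI)
  fix u assume *: "a \<in> {1..n}" "U \<subseteq> {1..n}" "a \<notin> U" "u \<in> U"
  then have "u \<in> {1..n}" "u \<noteq> a" by auto
  with *(1) show "pair_edge a u \<in> edges"
    by (cases "a < u") (auto simp: pair_edge_def edges_def)
qed

lemma prob_pair_edge: "(case pair_edge a u of (i, j) \<Rightarrow> edge_prob i j) = edge_prob a u"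
  by (auto simp: pair_edge_def edge_prob_def min_def max_def mult.commute)

lemma nbrs_iff:
  assumes "E \<subseteq> edges" "u \<in> U"
  shows "u \<in> nbrs E a U \<longleftrightarrow> pair_edge a u \<in> E"
  using assms by (auto simp: nbrs_def pair_edge_def edges_def min_def max_def)

lemma expectation_nbrs_prod:
  fixes y :: "nat \<Rightarrow> real"
  assumes a: "a \<in> {1..n}" and U: "U \<subseteq> {1..n}" "a \<notin> U" and y: "\<And>u. u \<in> U \<Longrightarrow> 0 \<le> y u"
  shows "measure_pmf.expectation (NR n v) (\<lambda>E. \<Prod>u\<in>nbrs E a U. y u) =
         (\<Prod>u\<in>U. 1 - edge_prob a u * (1 - y u))"
proof -
  have fin: "finite U" using U(1) finite_subset by auto
  have "measure_pmf.expectation (NR n v) (\<lambda>E. \<Prod>u\<in>nbrs E a U. y u) =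
    measure_pmf.expectation (NR n v) (\<lambda>E. \<Prod>u\<in>U. if pair_edge a u \<in> E then y u else 1)"
  proof (rule expectation_NR_cong)
    fix E assume E: "E \<subseteq> edges"
    have "(\<Prod>u\<in>nbrs E a U. y u) = (\<Prod>u\<in>U. if u \<in> nbrs E a U then y u else 1)"
      using fin nbrs_subset[of E a U]
      by (subst prod.inter_restrict[symmetric, OF fin]) (simp add: inf.absorb2)
    also have "\<dots> = (\<Prod>u\<in>U. if pair_edge a u \<in> E then y u else 1)"
      using nbrs_iff[OF E] by (intro prod.cong) auto
    finally show "(\<Prod>u\<in>nbrs E a U. y u) = (\<Prod>u\<in>U. if pair_edge a u \<in> E then y u else 1)" .
  qed
  also have "\<dots> = (\<Prod>u\<in>U. 1 - (case pair_edge a u of (i, j) \<Rightarrow> edge_prob i j) * (1 - y u))"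
    unfolding NR_eq
    by (rule random_set_expectation_prod[OF finite_edges fin inj_pair_edge pair_edge_in[OF a U]])
       (use y U a edge_prob_bounds in \<open>auto simp: prob_pair_edge\<close>)
  finally show ?thesis by (simp add: prob_pair_edge)
qed

lemma expectation_nbrs_sum:
  fixes g :: "nat \<Rightarrow> real"
  assumes a: "a \<in> {1..n}" and U: "U \<subseteq> {1..n}" "a \<notin> U"
  shows "measure_pmf.expectation (NR n v) (\<lambda>E. \<Sum>u\<in>nbrs E a U. g u) = (\<Sum>u\<in>U. edge_prob a u * g u)"
proof -
  have fin: "finite U" using U(1) finite_subset by auto
  have "measure_pmf.expectation (NR n v) (\<lambda>E. \<Sum>u\<in>nbrs E a U. g u) =
    measure_pmf.expectation (NR n v) (\<lambda>E. \<Sum>u\<in>U. g u * (if pair_edge a u \<in> E then 1 else 0))"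
  proof (rule expectation_NR_cong)
    fix E assume E: "E \<subseteq> edges"
    have "(\<Sum>u\<in>nbrs E a U. g u) = (\<Sum>u\<in>U. if u \<in> nbrs E a U then g u else 0)"
      using fin nbrs_subset[of E a U]
      by (subst sum.inter_restrict[symmetric, OF fin]) (simp add: inf.absorb2)
    also have "\<dots> = (\<Sum>u\<in>U. g u * (if pair_edge a u \<in> E then 1 else 0))"
      using nbrs_iff[OF E] by (intro sum.cong) auto
    finally show "(\<Sum>u\<in>nbrs E a U. g u) = (\<Sum>u\<in>U. g u * (if pair_edge a u \<in> E then 1 else 0))" .
  qed
  also have "\<dots> = (\<Sum>u\<in>U. g u * measure_pmf.expectation (NR n v) (\<lambda>E. if pair_edge a u \<in> E then 1 else 0))"
    by (simp add: Bochner_Integration.integral_sum)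
  also have "\<dots> = (\<Sum>u\<in>U. g u * edge_prob a u)"
  proof (rule sum.cong[OF refl])
    fix u assume u: "u \<in> U"
    have "pair_edge a u \<in> edges" using pair_edge_in[OF a U] u by auto
    moreover have "u \<in> {1..n}" using u U by auto
    ultimately show "g u * measure_pmf.expectation (NR n v) (\<lambda>E. if pair_edge a u \<in> E then 1 else 0) =
        g u * edge_prob a u"
      unfolding NR_eq
      using edge_prob_bounds[OF a \<open>u \<in> {1..n}\<close>]
      by (subst random_set_prob_mem[OF finite_edges]) (auto simp: prob_pair_edge)
  qed
  finally show ?thesis by (simp add: mult.commute)
qed

text \<open>The neighbours of \<open>a\<close> depend only on edges incident to \<open>a\<close>,
  and the rest of the exploration only on edges not incident to \<open>a\<close>. After
  \<open>reach_peel\<close> the two are independent, so the rest may be run in a fresh graph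
  \<open>E'\<close>.\<close>

lemma expectation_reach_peel:
  fixes h :: "nat set \<Rightarrow> real"
  assumes "a \<in> A" "a \<notin> U"
  shows "measure_pmf.expectation (NR n v) (\<lambda>E. h (reach E A U)) =
    measure_pmf.expectation (NR n v) (\<lambda>E. measure_pmf.expectation (NR n v)
      (\<lambda>E'. h (insert a (reach E' (A - {a} \<union> nbrs E a U) (U - nbrs E a U)))))"
proof -
  define J where "J = {a} \<times> UNIV \<union> UNIV \<times> {a}"
  define K where "K E E' = h (insert a (reach E' (A - {a} \<union> nbrs E a U) (U - nbrs E a U)))" for E E'
  have nbrs: "nbrs (E \<inter> J) a U = nbrs E a U" for E
    by (auto simp: nbrs_def J_def)
  have "reach (E' - J) (A - {a} \<union> nbrs E a U) (U - nbrs E a U) =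
      reach E' (A - {a} \<union> nbrs E a U) (U - nbrs E a U)" for E E'
    using assms by (intro reach_cong) (auto simp: J_def nbrs_def)
  then have K: "K (E \<inter> J) (E' - J) = K E E'" for E E'
    by (simp add: K_def nbrs)
  have "measure_pmf.expectation (NR n v) (\<lambda>E. h (reach E A U)) =
    measure_pmf.expectation (NR n v) (\<lambda>E. K (E \<inter> J) (E - J))"
    unfolding K by (simp add: K_def flip: reach_peel[OF assms])
  also have "\<dots> = measure_pmf.expectation (NR n v)
      (\<lambda>E. measure_pmf.expectation (NR n v) (\<lambda>E'. K (E \<inter> J) (E' - J)))"
    unfolding NR_eq by (rule random_set_expectation_split[OF finite_edges])
  finally show ?thesis unfolding K by (simp add: K_def)
qed

text \<open>A supermartingale bound for the exploration process: \<open>B\<close>, \<open>A\<close> and \<open>U\<close> are the explored,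
  active and unexplored vertices.\<close>

lemma exploration_bound:
  fixes h :: "nat set \<Rightarrow> real" and \<Phi> :: "nat set \<Rightarrow> nat set \<Rightarrow> nat set \<Rightarrow> real"
  assumes vertices: "\<And>B A U. Inv B A U \<Longrightarrow> A \<union> U \<subseteq> {1..n} \<and> A \<inter> U = {}"
    and inv: "\<And>B A U a N. Inv B A U \<Longrightarrow> a \<in> A \<Longrightarrow> N \<subseteq> U \<Longrightarrow> Inv (insert a B) (A - {a} \<union> N) (U - N)"
    and stop: "\<And>B U. Inv B {} U \<Longrightarrow> h B \<le> \<Phi> B {} U"
    and step: "\<And>B A U a. Inv B A U \<Longrightarrow> a \<in> A \<Longrightarrow>
      measure_pmf.expectation (NR n v)
        (\<lambda>E. \<Phi> (insert a B) (A - {a} \<union> nbrs E a U) (U - nbrs E a U)) \<le> \<Phi> B A U"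
    and start: "Inv B A U"
  shows "measure_pmf.expectation (NR n v) (\<lambda>E. h (B \<union> reach E A U)) \<le> \<Phi> B A U"
  using start
\<comment> \<open>Each step removes exactly \<open>a\<close> from the union of active and unexplored
  vertices, whatever its neighbours are.\<close>
proof (induction "card (A \<union> U)" arbitrary: B A U rule: less_induct)
  case less
  note V = vertices[OF less.prems]
  show ?case
  proof (cases "A = {}")
    case True
    then show ?thesis using stop less.prems by simp
  next
    case False
    then obtain a where a: "a \<in> A" by blast
    with V have aU: "a \<notin> U" by blast
    have fin: "finite (A \<union> U)" using V finite_subset by auto
    have IH: "measure_pmf.expectation (NR n v) (\<lambda>E. h (insert a B \<union> reach E (A - {a} \<union> N) (U - N)))
        \<le> \<Phi> (insert a B) (A - {a} \<union> N) (U - N)" if N: "N \<subseteq> U" for N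
    proof (rule less.hyps[OF _ inv[OF less.prems a N]])
      have "A - {a} \<union> N \<union> (U - N) = A \<union> U - {a}"
        using N aU by blast
      then show "card (A - {a} \<union> N \<union> (U - N)) < card (A \<union> U)"
        using fin a by (metis UnI1 card_Diff1_less)
    qed
    have "measure_pmf.expectation (NR n v) (\<lambda>E. h (B \<union> reach E A U)) =
      measure_pmf.expectation (NR n v) (\<lambda>E. measure_pmf.expectation (NR n v)
        (\<lambda>E'. h (insert a B \<union> reach E' (A - {a} \<union> nbrs E a U) (U - nbrs E a U))))"
      using expectation_reach_peel[OF a aU, of "\<lambda>C. h (B \<union> C)"] by simp
    also have "\<dots> \<le> measure_pmf.expectation (NR n v)
        (\<lambda>E. \<Phi> (insert a B) (A - {a} \<union> nbrs E a U) (U - nbrs E a U))"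
      by (intro expectation_NR_mono IH nbrs_subset)
    also have "\<dots> \<le> \<Phi> B A U"
      using step[OF less.prems a] .
    finally show ?thesis .
  qed
qed

end

section \<open>Cluster sums and Laplace transforms\<close>

text \<open>The product of 1 + y + y^2/2 and 1 - y + y^2/2 is 1 + y^4/4, hence at least 1. Since exp
  y dominates the first factor, exp (-y) is at most the second.\<close>

lemma one_minus_exp_neg_lower:
  fixes y :: real
  assumes "0 \<le> y"
  shows "y - y\<^sup>2 / 2 \<le> 1 - exp (- y)"
proof -
  have "1 \<le> (1 + y + y\<^sup>2 / 2) * (1 - y + y\<^sup>2 / 2)"
  proof -
    have "(1 + y + y\<^sup>2 / 2) * (1 - y + y\<^sup>2 / 2) = 1 + (y\<^sup>2)\<^sup>2 / 4"
      by (simp add: algebra_simps power2_eq_square)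
    then show ?thesis by simp
  qed
  also have "\<dots> \<le> exp y * (1 - y + y\<^sup>2 / 2)"
  proof (rule mult_right_mono)
    have "0 \<le> ((y - 1)\<^sup>2 + 1) / 2" by simp
    then show "0 \<le> 1 - y + y\<^sup>2 / 2" by (simp add: power2_eq_square algebra_simps)
  qed (rule exp_lower_Taylor_quadratic[OF assms])
  finally have "exp (- y) * 1 \<le> exp (- y) * (exp y * (1 - y + y\<^sup>2 / 2))"
    by (rule mult_left_mono) simp
  then show ?thesis by (simp flip: mult.assoc exp_add)
qed

text \<open>With p and q the two factors, (y - p)(z - q) >= 0 gives pq >= yz - y(z - q) - z(y - p),
  and both differences are at most quadratic.\<close>

lemma one_minus_exp_neg_prod_lower:
  fixes y z :: real
  assumes "0 \<le> y" "0 \<le> z"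
  shows "y * z - y * z\<^sup>2 / 2 - y\<^sup>2 * z / 2 \<le> (1 - exp (- y)) * (1 - exp (- z))"
proof -
  define p where "p = 1 - exp (- y)"
  define q where "q = 1 - exp (- z)"
  have p: "p \<le> y" "y - p \<le> y\<^sup>2 / 2"
    using exp_ge_add_one_self[of "- y"] one_minus_exp_neg_lower[OF assms(1)] by (auto simp: p_def)
  have q: "q \<le> z" "z - q \<le> z\<^sup>2 / 2"
    using exp_ge_add_one_self[of "- z"] one_minus_exp_neg_lower[OF assms(2)] by (auto simp: q_def)
  have "0 \<le> (y - p) * (z - q)" using p q by simp
  moreover have "y * (z - q) \<le> y * (z\<^sup>2 / 2)" "z * (y - p) \<le> z * (y\<^sup>2 / 2)"
    using mult_left_mono[OF q(2) assms(1)] mult_left_mono[OF p(2) assms(2)] by auto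
  ultimately show ?thesis
    unfolding p_def[symmetric] q_def[symmetric] by (simp add: algebra_simps)
qed

section \<open>First-moment and Laplace bounds for explored sets\<close>

context norros_reittu
begin

text \<open>An active vertex \<open>i\<close> is charged \<open>f i\<close> for itself and
  \<open>v i * G\<close> for its descendants. Edge probabilities are at most
  \<open>v a * v u / L\<close>, so hypothesis \<open>G\<close> says that the charges of the new
  neighbours of \<open>a\<close> have mean at most \<open>v a * G\<close>. Stating it on the fixed
  set \<open>U\<^sub>0\<close> makes it valid as the unexplored set shrinks.\<close>

lemma reach_sum_bound:
  fixes f :: "nat \<Rightarrow> real"
  assumes f: "\<And>i. i \<in> {1..n} \<Longrightarrow> 0 \<le> f i" and "0 \<le> G"
    and U0: "U\<^sub>0 \<subseteq> {1..n}"
    and G: "(\<Sum>u\<in>U\<^sub>0. v u * (f u + v u * G) / L) \<le> G"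
    and AU: "A \<subseteq> {1..n}" "U \<subseteq> U\<^sub>0" "A \<inter> U = {}"
  shows "measure_pmf.expectation (NR n v) (\<lambda>E. \<Sum>i\<in>reach E A U. f i) \<le> (\<Sum>i\<in>A. f i + v i * G)"
proof -
  define g where "g i = f i + v i * G" for i
  define \<Phi> where "\<Phi> B A U = (\<Sum>i\<in>B. f i) + (\<Sum>i\<in>A. g i)" for B A U :: "nat set"
  define Inv where "Inv B A U \<longleftrightarrow> B \<union> A \<union> U \<subseteq> {1..n} \<and> B \<inter> A = {} \<and> B \<inter> U = {} \<and> A \<inter> U = {} \<and> U \<subseteq> U\<^sub>0"
    for B A U
  have g: "0 \<le> g i" if "i \<in> {1..n}" for i
    using that f v_nonneg \<open>0 \<le> G\<close> by (simp add: g_def)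
  have "measure_pmf.expectation (NR n v) (\<lambda>E. \<Sum>i\<in>{} \<union> reach E A U. f i) \<le> \<Phi> {} A U"
  proof (rule exploration_bound[where Inv = Inv])
    fix B A U a
    assume I: "Inv B A U" and a: "a \<in> A"
    have fin: "finite B" "finite A" "finite U"
      using I finite_subset[of _ "{1..n}"] by (auto simp: Inv_def)
    have aV: "a \<in> {1..n}" "a \<notin> B" "a \<notin> U" using I a by (auto simp: Inv_def)
    have UV: "U \<subseteq> {1..n}" using I by (auto simp: Inv_def)
    have eq: "\<Phi> (insert a B) (A - {a} \<union> nbrs E a U) (U - nbrs E a U) =
        (f a + (\<Sum>i\<in>B. f i) + (\<Sum>i\<in>A - {a}. g i)) + (\<Sum>u\<in>nbrs E a U. g u)" for E
    proof -
      have "(\<Sum>i\<in>A - {a} \<union> nbrs E a U. g i) = (\<Sum>i\<in>A - {a}. g i) + (\<Sum>u\<in>nbrs E a U. g u)"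
        using fin nbrs_subset[of E a U] I
        by (intro sum.union_disjoint) (auto simp: Inv_def intro: finite_subset)
      then show ?thesis using fin aV by (simp add: \<Phi>_def)
    qed
    have "(\<Sum>u\<in>U. edge_prob a u * g u) \<le> (\<Sum>u\<in>U. v a * (v u * g u / L))"
    proof (rule sum_mono)
      fix u assume "u \<in> U"
      then have u: "u \<in> {1..n}" using UV by auto
      have "edge_prob a u * g u \<le> v a * v u / L * g u"
        by (rule mult_right_mono[OF edge_prob_bounds(3)[OF aV(1) u] g[OF u]])
      then show "edge_prob a u * g u \<le> v a * (v u * g u / L)" by (simp add: mult_ac)
    qed
    also have "\<dots> = v a * (\<Sum>u\<in>U. v u * g u / L)"
      by (simp add: sum_distrib_left)
    also have "\<dots> \<le> v a * (\<Sum>u\<in>U\<^sub>0. v u * g u / L)"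
    proof (intro mult_left_mono sum_mono2)
      show "finite U\<^sub>0" using U0 finite_subset by auto
      show "0 \<le> v u * g u / L" if "u \<in> U\<^sub>0 - U" for u
        using that U0 g[of u] v_nonneg[of u] total_pos by auto
    qed (use I aV v_nonneg in \<open>auto simp: Inv_def\<close>)
    also have "\<dots> \<le> v a * G"
      using G v_nonneg[OF aV(1)] by (intro mult_left_mono) (auto simp: g_def)
    finally have "(\<Sum>u\<in>U. edge_prob a u * g u) \<le> v a * G" .
    moreover have "(\<Sum>i\<in>A. g i) = g a + (\<Sum>i\<in>A - {a}. g i)"
      using fin a by (simp add: sum.remove)
    ultimately show "measure_pmf.expectation (NR n v)
        (\<lambda>E. \<Phi> (insert a B) (A - {a} \<union> nbrs E a U) (U - nbrs E a U)) \<le> \<Phi> B A U"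
      unfolding eq by (simp add: expectation_nbrs_sum[OF aV(1) UV aV(3)] \<Phi>_def g_def)
  qed (use AU U0 in \<open>auto simp: Inv_def \<Phi>_def\<close>)
  then show ?thesis by (simp add: \<Phi>_def g_def)
qed

text \<open>The functional \<open>q\<close> measures how much of the offspring mean has been used
  up. While it stays within the budget \<open>d\<close>, the remaining vertices still supply the
  drift that makes the exponential superharmonic. The last two sums in \<open>drift\<close> pay for
  the second-order terms of the Laplace transform and of the edge probabilities.\<close>

lemma reach_laplace_bound:
  fixes s \<delta> d M :: real
  defines "q S \<equiv> \<Sum>u\<in>S. v u * (v u + \<delta>) / L"
  assumes U0: "U\<^sub>0 \<subseteq> {1..n}" and a0: "a\<^sub>0 \<in> {1..n}" "a\<^sub>0 \<notin> U\<^sub>0"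
    and nn: "0 \<le> s" "0 \<le> \<delta>" "0 \<le> d" and M: "\<And>i. i \<in> {1..n} \<Longrightarrow> v i \<le> M"
    and drift: "1 + d + s / 2 * (\<Sum>u\<in>U\<^sub>0. v u * (v u + \<delta>)\<^sup>2 / L)
        + M / (2 * L) * (\<Sum>u\<in>U\<^sub>0. (v u)\<^sup>2 * (v u + \<delta>) / L) \<le> q U\<^sub>0"
  shows "measure_pmf.expectation (NR n v)
      (\<lambda>E. if q (reach E {a\<^sub>0} U\<^sub>0 \<inter> U\<^sub>0) \<le> d then exp (- (s * \<delta> * card (reach E {a\<^sub>0} U\<^sub>0))) else 0)
    \<le> exp (- (s * (v a\<^sub>0 + \<delta>)))"
proof -
  define g where "g i = v i + \<delta>" for i
  define h where "h C = (if q (C \<inter> U\<^sub>0) \<le> d then exp (- (s * \<delta> * card C)) else 0)" for C :: "nat set"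
  \<comment> \<open>The exponential is killed when the budget is exceeded. Discovered vertices stay
    discovered, so it then remains 0.\<close>
  define \<Phi> where "\<Phi> B A U = (if q ((B \<union> A) \<inter> U\<^sub>0) \<le> d
      then exp (- (s * \<delta> * card B) - s * (\<Sum>i\<in>A. g i)) else 0)" for B A U :: "nat set"
  \<comment> \<open>The last inclusion ensures that \<open>U\<close> is exactly
    \<open>U\<^sub>0\<close> minus the discovered vertices, so its share of \<open>q\<close> is
    \<open>q U\<^sub>0\<close> minus what has been used.\<close>
  define Inv where "Inv B A U \<longleftrightarrow> B \<union> A \<union> U \<subseteq> {1..n} \<and> B \<inter> A = {} \<and> B \<inter> U = {} \<and> A \<inter> U = {} \<and>
      U \<subseteq> U\<^sub>0 \<and> U\<^sub>0 \<subseteq> B \<union> A \<union> U" for B A U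
  have g: "0 \<le> g i" if "i \<in> {1..n}" for i
    using that v_nonneg nn by (simp add: g_def)
  have finU0: "finite U\<^sub>0" using U0 finite_subset by auto
  have q_nonneg: "0 \<le> v u * (v u + \<delta>) / L" if "u \<in> U\<^sub>0" for u
    using that U0 v_nonneg[of u] nn total_pos by auto
  have q_mono: "q S \<le> q T" if "S \<subseteq> T" "T \<subseteq> U\<^sub>0" for S T
    unfolding q_def using that finU0 q_nonneg by (intro sum_mono2) (auto intro: finite_subset)
  have "measure_pmf.expectation (NR n v) (\<lambda>E. h ({} \<union> reach E {a\<^sub>0} U\<^sub>0)) \<le> \<Phi> {} {a\<^sub>0} U\<^sub>0"
  proof (rule exploration_bound[where Inv = Inv])
    fix B A U a
    assume I: "Inv B A U" and a: "a \<in> A"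
    have fin: "finite B" "finite A" "finite U"
      using I finite_subset[of _ "{1..n}"] by (auto simp: Inv_def)
    have aV: "a \<in> {1..n}" "a \<notin> B" "a \<notin> U" using I a by (auto simp: Inv_def)
    have UV: "U \<subseteq> {1..n}" using I by (auto simp: Inv_def)
    have va: "0 \<le> v a" using v_nonneg aV by auto
    show "measure_pmf.expectation (NR n v)
        (\<lambda>E. \<Phi> (insert a B) (A - {a} \<union> nbrs E a U) (U - nbrs E a U)) \<le> \<Phi> B A U"
    proof (cases "q ((B \<union> A) \<inter> U\<^sub>0) \<le> d")
      case False
      have "\<Phi> (insert a B) (A - {a} \<union> nbrs E a U) (U - nbrs E a U) = 0" for E
        using False q_mono[of "(B \<union> A) \<inter> U\<^sub>0" "(insert a B \<union> (A - {a} \<union> nbrs E a U)) \<inter> U\<^sub>0"]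
        by (force simp: \<Phi>_def)
      then show ?thesis using False by (simp add: \<Phi>_def)
    next
      case True
      define c where "c = exp (- (s * \<delta> * (card B + 1)) - s * (\<Sum>i\<in>A - {a}. g i))"
      \<comment> \<open>An inequality, because the new neighbours may exceed the budget and make the
        left side 0.\<close>
      have le: "\<Phi> (insert a B) (A - {a} \<union> nbrs E a U) (U - nbrs E a U) \<le>
          c * (\<Prod>u\<in>nbrs E a U. exp (- (s * g u)))" for E
      proof -
        have finN: "finite (nbrs E a U)" using fin nbrs_subset[of E a U] finite_subset by blast
        have "(\<Sum>i\<in>A - {a} \<union> nbrs E a U. g i) = (\<Sum>i\<in>A - {a}. g i) + (\<Sum>u\<in>nbrs E a U. g u)"
          using fin finN nbrs_subset[of E a U] I
          by (intro sum.union_disjoint) (auto simp: Inv_def)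
        then have "exp (- (s * \<delta> * card (insert a B)) - s * (\<Sum>i\<in>A - {a} \<union> nbrs E a U. g i)) =
            c * exp (\<Sum>u\<in>nbrs E a U. - (s * g u))"
          using fin aV by (simp add: c_def sum_negf algebra_simps flip: exp_add sum_distrib_left)
        then show ?thesis
          by (auto simp: \<Phi>_def exp_sum[OF finN] c_def intro!: mult_nonneg_nonneg prod_nonneg)
      qed
      \<comment> \<open>Processing \<open>a\<close> takes \<open>s * g a\<close> out of the
        exponent. Of this, \<open>s * \<delta>\<close> is taken over by the count of explored
        vertices, so the offspring only has to restore \<open>s * v a\<close>.\<close>
      have "s * v a \<le> (\<Sum>u\<in>U. edge_prob a u * (1 - exp (- (s * g u))))"
      proof -
        \<comment> \<open>\<open>s * v a * T\<close> is the sum over \<open>U\<close> of the lower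
          bounds from \<open>one_minus_exp_neg_prod_lower\<close>. The budget and
          \<open>drift\<close> give \<open>1 \<le> T\<close>.\<close>
        define T where "T = (\<Sum>u\<in>U. v u * g u / L) - s / 2 * (\<Sum>u\<in>U. v u * (g u)\<^sup>2 / L)
            - v a / (2 * L) * (\<Sum>u\<in>U. (v u)\<^sup>2 * g u / L)"
        have Ueq: "U\<^sub>0 - (B \<union> A) \<inter> U\<^sub>0 = U" using I by (auto simp: Inv_def)
        have "(\<Sum>u\<in>U. v u * g u / L) = q U\<^sub>0 - q ((B \<union> A) \<inter> U\<^sub>0)"
          unfolding q_def Ueq[symmetric] g_def using finU0 by (intro sum_diff) auto
        moreover have "s / 2 * (\<Sum>u\<in>U. v u * (g u)\<^sup>2 / L) \<le> s / 2 * (\<Sum>u\<in>U\<^sub>0. v u * (g u)\<^sup>2 / L)"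
        proof (intro mult_left_mono sum_mono2)
          show "0 \<le> v u * (g u)\<^sup>2 / L" if "u \<in> U\<^sub>0 - U" for u
            using that U0 v_nonneg[of u] total_pos by auto
        qed (use finU0 nn I in \<open>auto simp: Inv_def\<close>)
        moreover have "v a / (2 * L) * (\<Sum>u\<in>U. (v u)\<^sup>2 * g u / L) \<le>
            M / (2 * L) * (\<Sum>u\<in>U\<^sub>0. (v u)\<^sup>2 * g u / L)"
        proof (intro mult_mono sum_mono2)
          show "v a / (2 * L) \<le> M / (2 * L)"
            using M[OF aV(1)] total_pos by (intro divide_right_mono) auto
          show "0 \<le> M / (2 * L)" using M[OF aV(1)] va total_pos by auto
          show "0 \<le> (v u)\<^sup>2 * g u / L" if "u \<in> U\<^sub>0 - U" for u
            using that U0 g[of u] total_pos by auto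
          show "0 \<le> (\<Sum>u\<in>U. (v u)\<^sup>2 * g u / L)"
            using UV g total_pos by (intro sum_nonneg) auto
        qed (use finU0 nn I in \<open>auto simp: Inv_def\<close>)
        ultimately have "1 \<le> T"
          using True drift unfolding T_def g_def by linarith
        then have "s * v a \<le> s * v a * T"
          using mult_left_mono[of 1 T "s * v a"] nn(1) va by simp
        also have "\<dots> = (\<Sum>u\<in>U. (v a * v u / L) * (s * g u) - (v a * v u / L) * (s * g u)\<^sup>2 / 2
            - (v a * v u / L)\<^sup>2 * (s * g u) / 2)"
          unfolding T_def sum_subtractf sum_distrib_left right_diff_distrib
          by (intro arg_cong2[where f = "(-)"] sum.cong refl) (simp_all add: power2_eq_square field_simps)
        also have "\<dots> \<le> (\<Sum>u\<in>U. edge_prob a u * (1 - exp (- (s * g u))))"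
          unfolding edge_prob_def
        proof (intro sum_mono one_minus_exp_neg_prod_lower)
          fix u assume "u \<in> U"
          then have "u \<in> {1..n}" using UV by auto
          then show "0 \<le> v a * v u / L" "0 \<le> s * g u"
            using va v_nonneg total_pos nn g by auto
        qed
        finally show ?thesis .
      qed
      note key = this
      have "measure_pmf.expectation (NR n v)
          (\<lambda>E. \<Phi> (insert a B) (A - {a} \<union> nbrs E a U) (U - nbrs E a U)) \<le>
        measure_pmf.expectation (NR n v) (\<lambda>E. c * (\<Prod>u\<in>nbrs E a U. exp (- (s * g u))))"
        by (rule expectation_NR_mono) (rule le)
      also have "\<dots> = c * (\<Prod>u\<in>U. 1 - edge_prob a u * (1 - exp (- (s * g u))))"
        by (simp add: expectation_nbrs_prod[OF aV(1) UV aV(3)])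
      also have "\<dots> \<le> c * (\<Prod>u\<in>U. exp (- (edge_prob a u * (1 - exp (- (s * g u))))))"
      proof (intro mult_left_mono prod_mono conjI)
        fix u assume "u \<in> U"
        then have u: "u \<in> {1..n}" using UV by auto
        have "edge_prob a u * (1 - exp (- (s * g u))) \<le> 1 * 1"
          using edge_prob_bounds[OF aV(1) u] nn g[OF u] by (intro mult_mono) auto
        then show "0 \<le> 1 - edge_prob a u * (1 - exp (- (s * g u)))" by simp
        show "1 - edge_prob a u * (1 - exp (- (s * g u))) \<le> exp (- (edge_prob a u * (1 - exp (- (s * g u)))))"
          using exp_ge_add_one_self[of "- (edge_prob a u * (1 - exp (- (s * g u))))"] by simp
      qed (simp add: c_def)
      also have "\<dots> = c * exp (- (\<Sum>u\<in>U. edge_prob a u * (1 - exp (- (s * g u)))))"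
        using fin by (simp add: exp_sum flip: sum_negf)
      also have "\<dots> \<le> c * exp (- (s * v a))"
        using key by (intro mult_left_mono) (auto simp: c_def)
      also have "\<dots> = exp (- (s * \<delta> * card B) - s * (\<Sum>i\<in>A. g i))"
        using fin a by (simp add: c_def g_def sum.remove[of A a] algebra_simps flip: exp_add)
      also have "\<dots> = \<Phi> B A U" using True by (simp add: \<Phi>_def)
      finally show ?thesis .
    qed
  qed (use U0 a0 in \<open>auto simp: Inv_def \<Phi>_def h_def\<close>)
  moreover have "\<Phi> {} {a\<^sub>0} U\<^sub>0 = exp (- (s * (v a\<^sub>0 + \<delta>)))"
    using a0 nn by (simp add: \<Phi>_def g_def q_def)
  ultimately show ?thesis by (simp add: h_def)
qed

end

section \<open>Tail bounds for the largest cluster\<close>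

lemma cluster_eq:
  assumes "y \<in> cluster E x"
  shows "cluster E y = cluster E x"
proof -
  have "sym ((E \<union> E\<inverse>)\<^sup>*)" by (intro sym_rtrancl) (auto simp: sym_def)
  then have "(y, x) \<in> (E \<union> E\<inverse>)\<^sup>*" "(x, y) \<in> (E \<union> E\<inverse>)\<^sup>*"
    using assms by (auto simp: cluster_def dest: symD)
  then show ?thesis by (auto simp: cluster_def)
qed

context norros_reittu
begin

lemma n_pos: "1 \<le> n"
  using total_pos by (cases n) (auto simp: total_weight_def)

lemma edges_subset: "edges \<subseteq> {1..n} \<times> {1..n}"
  by (auto simp: edges_def)

lemma cluster_subset_vertices:
  assumes "E \<subseteq> edges" "x \<in> {1..n}"
  shows "cluster E x \<subseteq> {1..n}"
  using cluster_subset[of "{1..n}" "{1..n}" x E] assms edges_subset by blast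

lemma card_cluster_le_max:
  assumes "x \<in> {1..n}"
  shows "card (cluster E x) \<le> max_cluster_size n E"
  unfolding max_cluster_size_def using assms by (intro Max_ge) auto

lemma max_cluster_attained: "\<exists>x\<in>{1..n}. max_cluster_size n E = card (cluster E x)"
proof -
  have "max_cluster_size n E \<in> (\<lambda>x. card (cluster E x)) ` {1..n}"
    unfolding max_cluster_size_def using n_pos by (intro Max_in) auto
  then show ?thesis by auto
qed

lemma sum_subset_total:
  assumes "S \<subseteq> {1..n}"
  shows "(\<Sum>u\<in>S. v u) \<le> L"
  unfolding total_weight_def using assms v_nonneg by (intro sum_mono2) auto

text \<open>A cluster larger than \<open>k\<close> is either covered by the exploration from
  \<open>H\<close>, or it avoids \<open>H\<close> and each of its more than \<open>k\<close>
  vertices has a hub-free cluster larger than \<open>k\<close>, so that the sizes sum to at least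
  \<open>k\<^sup>2\<close>. Markov's inequality handles both cases, which explains the two
  denominators.\<close>

lemma max_cluster_upper_tail:
  fixes x k :: real
  assumes H: "H \<subseteq> {1..n}" and x: "0 < x" and k: "0 < k"
    and subcrit: "(\<Sum>u\<in>{1..n} - H. (v u)\<^sup>2 / L) \<le> 1 - x"
  shows "measure_pmf.prob (NR n v) {E. k < real (max_cluster_size n E)} \<le>
    (card H + (\<Sum>u\<in>H. v u) / x) / k + (n + L / x) / k\<^sup>2"
proof -
  let ?U = "{1..n} - H"
  let ?c1 = "\<lambda>E. real (card (reach E H ?U))"
  let ?c2 = "\<lambda>y E. real (card (reach E {y} (?U - {y})))"
  \<comment> \<open>The charge \<open>1 / x\<close> solves G = 1 + (1 - x) G, the equation for
    counting vertices with offspring mean at most 1 - x.\<close>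
  have card_bound: "measure_pmf.expectation (NR n v) (\<lambda>E. real (card (reach E A U))) \<le>
      (\<Sum>i\<in>A. 1 + v i / x)" if "A \<subseteq> {1..n}" "U \<subseteq> ?U" "A \<inter> U = {}" for A U
  proof -
    have "(\<Sum>u\<in>?U. v u * (1 + v u * (1 / x)) / L) = (\<Sum>u\<in>?U. v u) / L + (\<Sum>u\<in>?U. (v u)\<^sup>2 / L) / x"
      by (simp add: sum_divide_distrib power2_eq_square distrib_left add_divide_distrib
          divide_divide_eq_left mult.commute flip: sum.distrib)
    also have "\<dots> \<le> 1 + (1 - x) / x"
      using sum_subset_total[of ?U] total_pos subcrit x
      by (intro add_mono divide_right_mono) auto
    also have "\<dots> = 1 / x" using x by (simp add: field_simps)
    finally show ?thesis
      using reach_sum_bound[of "\<lambda>_. 1" "1 / x" ?U A U] x that by simp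
  qed
  have fin_reach: "finite (reach E A U)" if "A \<subseteq> {1..n}" "U \<subseteq> {1..n}" for E A U
    using that finite_subset[of _ "{1..n}"] by (intro finite_reach) auto
  have "measure_pmf.prob (NR n v) {E. k < real (max_cluster_size n E)} =
      measure_pmf.expectation (NR n v) (\<lambda>E. indicator {E. k < real (max_cluster_size n E)} E)"
    by simp
  also have "\<dots> \<le> measure_pmf.expectation (NR n v) (\<lambda>E. ?c1 E / k + (\<Sum>y\<in>?U. ?c2 y E) / k\<^sup>2)"
  proof (rule expectation_NR_mono)
    fix E assume E: "E \<subseteq> edges"
    then have EV: "E \<subseteq> {1..n} \<times> {1..n}" using edges_subset by blast
    show "indicator {E. k < real (max_cluster_size n E)} E \<le> ?c1 E / k + (\<Sum>y\<in>?U. ?c2 y E) / k\<^sup>2"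
    proof (cases "k < real (max_cluster_size n E)")
      case True
      obtain z where z: "z \<in> {1..n}" "max_cluster_size n E = card (cluster E z)"
        using max_cluster_attained by blast
      define C where "C = cluster E z"
      have kC: "k < card C" using True z by (simp add: C_def)
      have CV: "C \<subseteq> {1..n}" using cluster_subset_vertices[OF E z(1)] by (simp add: C_def)
      show ?thesis
      proof (cases "C \<subseteq> reach E H ?U")
        case True
        then have "card C \<le> card (reach E H ?U)"
          using fin_reach[of H ?U E] H by (intro card_mono) auto
        then have "k \<le> ?c1 E" using kC by linarith
        then have "1 \<le> ?c1 E / k" using k by simp
        moreover have "0 \<le> (\<Sum>y\<in>?U. ?c2 y E) / k\<^sup>2" by (intro divide_nonneg_nonneg sum_nonneg) auto
        ultimately show ?thesis by (simp add: indicator_def)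
      next
        case False
        have *: "y \<in> ?U \<and> k \<le> ?c2 y E" if "y \<in> C" for y
        proof -
          have "cluster E y = C" using that cluster_eq by (simp add: C_def)
          moreover have "y \<in> {1..n}" using that CV by auto
          ultimately have **: "y \<in> ?U" "C \<subseteq> reach E {y} (?U - {y})"
            using cluster_subset_reach[OF EV _ H, of y] False by auto
          then have "card C \<le> card (reach E {y} (?U - {y}))"
            using fin_reach[of "{y}" "?U - {y}" E] by (intro card_mono) auto
          then show ?thesis using ** kC by linarith
        qed
        have "k\<^sup>2 \<le> card C * k"
          using kC k by (simp add: power2_eq_square)
        also have "\<dots> = (\<Sum>y\<in>C. k)" by simp
        also have "\<dots> \<le> (\<Sum>y\<in>C. ?c2 y E)" using * by (intro sum_mono) auto
        also have "\<dots> \<le> (\<Sum>y\<in>?U. ?c2 y E)" using * by (intro sum_mono2) auto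
        finally have "1 \<le> (\<Sum>y\<in>?U. ?c2 y E) / k\<^sup>2" using k by simp
        moreover have "0 \<le> ?c1 E / k" using k by simp
        ultimately show ?thesis by (simp add: indicator_def)
      qed
    next
      case False
      then show ?thesis using k by (auto intro!: add_nonneg_nonneg divide_nonneg_nonneg sum_nonneg)
    qed
  qed
  also have "\<dots> = measure_pmf.expectation (NR n v) ?c1 / k +
      (\<Sum>y\<in>?U. measure_pmf.expectation (NR n v) (?c2 y)) / k\<^sup>2"
    by simp
  also have "\<dots> \<le> (card H + (\<Sum>u\<in>H. v u) / x) / k + (n + L / x) / k\<^sup>2"
  proof (intro add_mono divide_right_mono)
    show "measure_pmf.expectation (NR n v) ?c1 \<le> card H + (\<Sum>u\<in>H. v u) / x"
      using card_bound[of H ?U] H by (simp add: sum.distrib sum_divide_distrib)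
    have "(\<Sum>y\<in>?U. measure_pmf.expectation (NR n v) (?c2 y)) \<le> (\<Sum>y\<in>?U. 1 + v y / x)"
    proof (rule sum_mono)
      fix y assume "y \<in> ?U"
      then show "measure_pmf.expectation (NR n v) (?c2 y) \<le> 1 + v y / x"
        using card_bound[of "{y}" "?U - {y}"] by auto
    qed
    also have "\<dots> = card ?U + (\<Sum>y\<in>?U. v y) / x"
      by (simp add: sum.distrib sum_divide_distrib)
    also have "\<dots> \<le> n + L / x"
    proof (intro add_mono divide_right_mono)
      show "real (card ?U) \<le> n" using card_mono[of "{1..n}" ?U] by simp
    qed (use sum_subset_total[of ?U] x in auto)
    finally show "(\<Sum>y\<in>?U. measure_pmf.expectation (NR n v) (?c2 y)) \<le> n + L / x" .
  qed (use k in auto)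
  finally show ?thesis .
qed

text \<open>If the maximum is below \<open>k\<close>, the hub-free exploration from \<open>a\<close>
  finds at most \<open>k\<close> vertices. Either it stays within the budget, and the Laplace bound
  makes this unlikely, or it exceeds the budget, whose mean is controlled by
  \<open>reach_sum_bound\<close>.\<close>

lemma max_cluster_lower_tail:
  fixes s \<delta> d x M k :: real
  assumes U: "U \<subseteq> {1..n}" and a: "a \<in> {1..n}" "a \<notin> U"
    and nn: "0 \<le> s" "0 \<le> \<delta>" "0 < d" "0 < x"
    and M: "\<And>i. i \<in> {1..n} \<Longrightarrow> v i \<le> M"
    and subcrit: "(\<Sum>u\<in>U. (v u)\<^sup>2 / L) \<le> 1 - x"
    and drift: "1 + d + s / 2 * (\<Sum>u\<in>U. v u * (v u + \<delta>)\<^sup>2 / L)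
        + M / (2 * L) * (\<Sum>u\<in>U. (v u)\<^sup>2 * (v u + \<delta>) / L) \<le> (\<Sum>u\<in>U. v u * (v u + \<delta>) / L)"
  shows "measure_pmf.prob (NR n v) {E. real (max_cluster_size n E) < k} \<le>
    exp (s * \<delta> * k - s * v a) + M / (L * x * d) * (\<Sum>u\<in>U. (v u)\<^sup>2 * (v u + \<delta>) / L)"
proof -
  define q where "q S = (\<Sum>u\<in>S. v u * (v u + \<delta>) / L)" for S
  \<comment> \<open>Vanishing off \<open>U\<close>, \<open>f\<close> expresses the used budget as a
    sum over the explored set; in particular the start \<open>a\<close> costs nothing.\<close>
  define f where "f u = (if u \<in> U then v u * (v u + \<delta>) / L else 0)" for u
  define T where "T = (\<Sum>u\<in>U. (v u)\<^sup>2 * (v u + \<delta>) / L)"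
  define \<Psi> where "\<Psi> E = (if q (reach E {a} U \<inter> U) \<le> d
      then exp (- (s * \<delta> * card (reach E {a} U))) else 0)" for E
  have fin: "finite U" using U finite_subset by auto
  have T: "0 \<le> T" unfolding T_def
    using U v_nonneg nn total_pos by (intro sum_nonneg divide_nonneg_pos mult_nonneg_nonneg) auto
  have q_eq: "q (reach E {a} U \<inter> U) = (\<Sum>i\<in>reach E {a} U. f i)" for E
  proof -
    have "finite (reach E {a} U)" using fin by (intro finite_reach) auto
    then show ?thesis unfolding q_def f_def by (rule sum.inter_restrict)
  qed
  have f: "0 \<le> f i" if "i \<in> {1..n}" for i
    using that v_nonneg[of i] nn total_pos by (auto simp: f_def)
  have "measure_pmf.prob (NR n v) {E. real (max_cluster_size n E) < k} =
      measure_pmf.expectation (NR n v) (\<lambda>E. indicator {E. real (max_cluster_size n E) < k} E)"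
    by simp
  also have "\<dots> \<le> measure_pmf.expectation (NR n v)
      (\<lambda>E. exp (s * \<delta> * k) * \<Psi> E + (\<Sum>i\<in>reach E {a} U. f i) / d)"
  proof (rule expectation_NR_mono)
    fix E assume E: "E \<subseteq> edges"
    have reach_V: "reach E {a} U \<subseteq> {1..n}" using reach_subset[of E "{a}" U] U a by auto
    then have f_sum: "0 \<le> (\<Sum>i\<in>reach E {a} U. f i)" using f by (intro sum_nonneg) auto
    show "indicator {E. real (max_cluster_size n E) < k} E \<le>
        exp (s * \<delta> * k) * \<Psi> E + (\<Sum>i\<in>reach E {a} U. f i) / d"
    proof (cases "real (max_cluster_size n E) < k")
      case True
      have "card (reach E {a} U) \<le> card (cluster E a)"
        using reach_subset_cluster finite_subset[OF cluster_subset_vertices[OF E a(1)]]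
        by (intro card_mono) auto
      also have "\<dots> \<le> max_cluster_size n E" by (rule card_cluster_le_max[OF a(1)])
      finally have card: "real (card (reach E {a} U)) \<le> k" using True by linarith
      show ?thesis
      proof (cases "q (reach E {a} U \<inter> U) \<le> d")
        case True
        have "1 \<le> exp (s * \<delta> * k) * \<Psi> E"
          using True card nn by (simp add: \<Psi>_def mult_left_mono flip: exp_add)
        moreover have "0 \<le> (\<Sum>i\<in>reach E {a} U. f i) / d" using f_sum nn by simp
        ultimately show ?thesis by (simp add: indicator_def)
      next
        case False
        then have "1 \<le> (\<Sum>i\<in>reach E {a} U. f i) / d" using nn by (simp flip: q_eq)
        then show ?thesis using False by (simp add: indicator_def \<Psi>_def)
      qed
    next
      case False
      then show ?thesis using f_sum nn by (simp add: \<Psi>_def)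
    qed
  qed
  also have "\<dots> = exp (s * \<delta> * k) * measure_pmf.expectation (NR n v) \<Psi> +
      measure_pmf.expectation (NR n v) (\<lambda>E. \<Sum>i\<in>reach E {a} U. f i) / d"
    by simp
  also have "\<dots> \<le> exp (s * \<delta> * k) * exp (- (s * v a)) + M * (T / L / x) / d"
  proof (intro add_mono mult_left_mono divide_right_mono)
    have "measure_pmf.expectation (NR n v) \<Psi> \<le> exp (- (s * (v a + \<delta>)))"
      unfolding \<Psi>_def q_def
      by (rule reach_laplace_bound[where M = M]) (use U a nn M drift in auto)
    also have "\<dots> \<le> exp (- (s * v a))" using nn by (simp add: mult_left_mono)
    finally show "measure_pmf.expectation (NR n v) \<Psi> \<le> exp (- (s * v a))" .
    have "measure_pmf.expectation (NR n v) (\<lambda>E. \<Sum>i\<in>reach E {a} U. f i) \<le>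
        (\<Sum>i\<in>{a}. f i + v i * (T / L / x))"
    \<comment> \<open>Here the charge is the solution G = T / (L x) of G = T / L + (1 - x)
      G.\<close>
    proof (rule reach_sum_bound[where U\<^sub>0 = U])
      have "(\<Sum>u\<in>U. v u * (f u + v u * (T / L / x)) / L) =
          (\<Sum>u\<in>U. (v u)\<^sup>2 * (v u + \<delta>) / L / L + (v u)\<^sup>2 / L * (T / L / x))"
        by (intro sum.cong refl)
           (simp add: f_def power2_eq_square distrib_left add_divide_distrib mult_ac)
      also have "\<dots> = T / L + (\<Sum>u\<in>U. (v u)\<^sup>2 / L) * (T / L / x)"
        by (simp add: sum.distrib T_def flip: sum_divide_distrib sum_distrib_right)
      also have "\<dots> \<le> T / L + (1 - x) * (T / L / x)"
        using subcrit T total_pos nn by (intro add_left_mono mult_right_mono) auto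
      also have "\<dots> = T / L / x" using nn by (simp add: left_diff_distrib diff_divide_distrib)
      finally show "(\<Sum>u\<in>U. v u * (f u + v u * (T / L / x)) / L) \<le> T / L / x" .
    qed (use f U a T nn total_pos in auto)
    also have "\<dots> \<le> M * (T / L / x)"
      using a M[OF a(1)] T nn total_pos by (simp add: f_def mult_right_mono divide_right_mono)
    finally show "measure_pmf.expectation (NR n v) (\<lambda>E. \<Sum>i\<in>reach E {a} U. f i) \<le> M * (T / L / x)" .
  qed (use nn in auto)
  also have "\<dots> = exp (s * \<delta> * k - s * v a) + M / (L * x * d) * T"
    by (simp add: exp_diff exp_minus field_simps)
  finally show ?thesis by (simp add: T_def)
qed

end

section \<open>The critical window\<close>

text \<open>Here \<open>A\<close> stands for \<open>n powr (1 / (\<tau> - 1))\<close>, so that \<open>A\<^sup>2 / n\<close> is the width of the critical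
  window and \<open>n / A\<close> the order of the largest cluster; the hubs are the vertices in \<open>{1..R}\<close>.\<close>

locale critical_weights = norros_reittu +
  fixes R :: nat and A K c :: real
  assumes A: "1 \<le> A" "A\<^sup>2 \<le> real n" and c: "0 < c" and K: "1 \<le> K" and R: "1 \<le> R" "R \<le> n"
    and v_upper: "\<And>i. i \<in> {1..n} \<Longrightarrow> v i \<le> K * A"
    and v_hub: "c * A \<le> v 1"
    and L_lower: "c * n \<le> total_weight n v" and L_upper: "total_weight n v \<le> K * n"
    and nu_upper: "(\<Sum>u\<in>{1..n} - {1..R}. (v u)\<^sup>2 / total_weight n v) \<le> 1 - A\<^sup>2 / n"
    and nu_lower: "1 - K * (A\<^sup>2 / n) \<le> (\<Sum>u\<in>{1..n} - {1..R}. (v u)\<^sup>2 / total_weight n v)"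
    and mass: "1 / 2 \<le> (\<Sum>u\<in>{1..n} - {1..R}. v u / total_weight n v)"
    and cubes: "(\<Sum>u\<in>{1..n} - {1..R}. v u * (v u + 1)\<^sup>2 / total_weight n v) \<le> K * (A ^ 3 / n)"
begin

lemma n_ge: "1 \<le> real n" "A \<le> real n"
  using A self_le_power[of A 2] by auto

lemma upper_tail:
  assumes "1 < \<omega>"
  shows "measure_pmf.prob (NR n v) {E. \<omega> * (real n / A) < real (max_cluster_size n E)} \<le>
    (real R + 1) * (K + 1) / \<omega>"
proof -
  let ?k = "\<omega> * (real n / A)"
  have pos: "0 < A" "0 < real n" "0 < \<omega>" using A n_ge assms by auto
  have "measure_pmf.prob (NR n v) {E. ?k < real (max_cluster_size n E)} \<le>
      (card {1..R} + (\<Sum>u\<in>{1..R}. v u) / (A\<^sup>2 / n)) / ?k + (n + L / (A\<^sup>2 / n)) / ?k\<^sup>2"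
    using R pos nu_upper by (intro max_cluster_upper_tail) auto
  \<comment> \<open>Everything is brought to the scale n / A: \<open>A \<le> n\<close> absorbs the
    number of hubs, \<open>A\<^sup>2 \<le> n\<close> gives n <= (n/A)^2, and dividing a hub weight
    of order A by the window width gives n / A.\<close>
  also have "\<dots> \<le> (R * (real n / A) + R * K * (real n / A)) / ?k + ((real n / A)\<^sup>2 + K * (real n / A)\<^sup>2) / ?k\<^sup>2"
  proof (intro add_mono divide_right_mono)
    have "R * A \<le> R * real n" using n_ge by (intro mult_left_mono) auto
    then show "card {1..R} \<le> R * (real n / A)" using pos by (simp add: field_simps)
    have "(\<Sum>u\<in>{1..R}. v u) \<le> (\<Sum>u\<in>{1..R}. K * A)" using R by (intro sum_mono v_upper) auto
    then have "(\<Sum>u\<in>{1..R}. v u) / (A\<^sup>2 / n) \<le> R * (K * A) / (A\<^sup>2 / n)"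
      using pos by (intro divide_right_mono) auto
    also have "\<dots> = R * K * (real n / A)" using pos by (simp add: power2_eq_square)
    finally show "(\<Sum>u\<in>{1..R}. v u) / (A\<^sup>2 / n) \<le> R * K * (real n / A)" .
    have "n * A\<^sup>2 \<le> real n * n" using A by (intro mult_left_mono) auto
    then show "real n \<le> (real n / A)\<^sup>2" using pos by (simp add: power_divide power2_eq_square field_simps)
    have "L / (A\<^sup>2 / n) \<le> K * n / (A\<^sup>2 / n)"
      using pos L_upper by (intro divide_right_mono) auto
    also have "\<dots> = K * (real n / A)\<^sup>2" using pos by (simp add: power_divide power2_eq_square)
    finally show "L / (A\<^sup>2 / n) \<le> K * (real n / A)\<^sup>2" .
  qed (use pos in auto)
  also have "\<dots> = R * (1 + K) / \<omega> + (1 + K) / \<omega>\<^sup>2"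
  proof -
    have "(R * y + R * K * y) / (\<omega> * y) + (y\<^sup>2 + K * y\<^sup>2) / (\<omega> * y)\<^sup>2 = R * (1 + K) / \<omega> + (1 + K) / \<omega>\<^sup>2"
      if "0 < y" for y :: real
      using that pos by (simp add: power_mult_distrib field_simps)
    from this[of "real n / A"] show ?thesis using pos by simp
  qed
  also have "\<dots> \<le> R * (1 + K) / \<omega> + (1 + K) / \<omega>"
    using pos assms K self_le_power[of \<omega> 2] by (intro add_left_mono divide_left_mono) auto
  also have "\<dots> = (real R + 1) * (K + 1) / \<omega>" by (simp add: algebra_simps add_divide_distrib)
  finally show ?thesis .
qed

text \<open>The constants of the lower bound: \<open>\<delta> \<omega>\<close> is what the exploration needs to compensate the missing hubs,
  the budget \<open>\<eta> * \<omega> * A\<^sup>2 / n\<close> for used-up vertices, and the quadratic error terms; \<open>\<eta>\<close> is small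
  enough for the resulting loss to be at most half of the gain \<open>c * sqrt \<omega>\<close> from the hub.\<close>

definition D :: real where "D = 2 * (K + 1 + K\<^sup>2 / (2 * c))"

definition \<eta> :: real where "\<eta> = c / (2 * D)"

definition \<delta> :: "real \<Rightarrow> real" where "\<delta> \<omega> = D * (1 + \<eta> * \<omega> + sqrt \<omega>) * (A\<^sup>2 / n)"

text \<open>With s = sqrt \<omega> / A the hub gains at least c sqrt \<omega> in the exponent, while
  the loss is at most 2 D + (c/2) sqrt \<omega>. The remaining exponential decay is far stronger
  than 1/\<omega>; the bound of order 1/\<omega> on exceeding the budget fixes the rate.\<close>

lemma lower_tail:
  assumes \<omega>: "1 < \<omega>" and \<delta>1: "\<delta> \<omega> \<le> 1"
  shows "measure_pmf.prob (NR n v) {E. real (max_cluster_size n E) < n / A / \<omega>} \<le>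
    (exp (2 * D) * (8 / c\<^sup>2) + K\<^sup>2 / (c * \<eta>)) / \<omega>"
proof -
  let ?U = "{1..n} - {1..R}"
  let ?x = "A\<^sup>2 / n"
  define s where "s = sqrt \<omega> / A"
  define d where "d = \<eta> * \<omega> * ?x"
  have pos: "0 < A" "0 < real n" "0 < \<omega>" "0 < c" "0 < K" using A n_ge \<omega> c K by auto
  have D: "2 \<le> D" using pos by (simp add: D_def)
  have \<eta>: "0 < \<eta>" using pos D by (simp add: \<eta>_def)
  have \<delta>0: "0 \<le> \<delta> \<omega>" using pos D \<eta> by (simp add: \<delta>_def)
  have v: "0 \<le> v u" if "u \<in> ?U" for u using that v_nonneg by auto
  \<comment> \<open>Since \<open>\<delta> \<omega> \<le> 1\<close>, the assumption
    \<open>cubes\<close> controls both second-order sums.\<close>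
  have T1: "(\<Sum>u\<in>?U. v u * (v u + \<delta> \<omega>)\<^sup>2 / L) \<le> K * (A ^ 3 / n)"
  proof (rule order_trans[OF _ cubes], rule sum_mono)
    fix u assume "u \<in> ?U"
    then show "v u * (v u + \<delta> \<omega>)\<^sup>2 / L \<le> v u * (v u + 1)\<^sup>2 / L"
      using v[of u] \<delta>0 \<delta>1 total_pos by (intro divide_right_mono mult_left_mono power_mono) auto
  qed
  have T2: "(\<Sum>u\<in>?U. (v u)\<^sup>2 * (v u + \<delta> \<omega>) / L) \<le> K * (A ^ 3 / n)"
  proof (rule order_trans[OF _ cubes], rule sum_mono)
    fix u assume "u \<in> ?U"
    then have "v u * (v u + \<delta> \<omega>) \<le> (v u + 1) * (v u + 1)"
      using v[of u] \<delta>0 \<delta>1 by (intro mult_mono) auto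
    then have "v u * (v u * (v u + \<delta> \<omega>)) \<le> v u * ((v u + 1) * (v u + 1))"
      using v[OF \<open>u \<in> ?U\<close>] by (rule mult_left_mono)
    then show "(v u)\<^sup>2 * (v u + \<delta> \<omega>) / L \<le> v u * (v u + 1)\<^sup>2 / L"
      using total_pos by (intro divide_right_mono) (auto simp: power2_eq_square mult_ac)
  qed
  have T2_nonneg: "0 \<le> (\<Sum>u\<in>?U. (v u)\<^sup>2 * (v u + \<delta> \<omega>) / L)"
    using v \<delta>0 total_pos by (intro sum_nonneg divide_nonneg_pos mult_nonneg_nonneg) auto
  have MLe: "K * A / (2 * L) \<le> K * A / (2 * (c * n))"
    using pos L_lower total_pos by (intro divide_left_mono) auto
  \<comment> \<open>The second-order term of the edge probabilities is quadratic in the window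
    width; this reduces it to linear order.\<close>
  have x_le: "?x\<^sup>2 \<le> ?x"
    using A pos by (intro power_le_one_iff[THEN iffD2] power_decreasing[of 1 2 ?x, simplified]) auto
  have drift: "1 + d + s / 2 * (\<Sum>u\<in>?U. v u * (v u + \<delta> \<omega>)\<^sup>2 / L)
      + K * A / (2 * L) * (\<Sum>u\<in>?U. (v u)\<^sup>2 * (v u + \<delta> \<omega>) / L) \<le> (\<Sum>u\<in>?U. v u * (v u + \<delta> \<omega>) / L)"
  proof -
    have "s / 2 * (\<Sum>u\<in>?U. v u * (v u + \<delta> \<omega>)\<^sup>2 / L) \<le> s / 2 * (K * (A ^ 3 / n))"
      using T1 pos by (intro mult_left_mono) (auto simp: s_def)
    also have "\<dots> = K / 2 * sqrt \<omega> * ?x"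
      using pos by (simp add: s_def power3_eq_cube power2_eq_square)
    finally have a: "s / 2 * (\<Sum>u\<in>?U. v u * (v u + \<delta> \<omega>)\<^sup>2 / L) \<le> K / 2 * sqrt \<omega> * ?x" .
    have "K * A / (2 * L) * (\<Sum>u\<in>?U. (v u)\<^sup>2 * (v u + \<delta> \<omega>) / L) \<le> K * A / (2 * (c * n)) * (K * (A ^ 3 / n))"
      using MLe T2 T2_nonneg pos by (intro mult_mono) auto
    also have "\<dots> = K\<^sup>2 / (2 * c) * ?x\<^sup>2"
      using pos by (simp add: power3_eq_cube power2_eq_square mult_ac)
    also have "\<dots> \<le> K\<^sup>2 / (2 * c) * ?x" using x_le pos by (intro mult_left_mono) auto
    finally have b: "K * A / (2 * L) * (\<Sum>u\<in>?U. (v u)\<^sup>2 * (v u + \<delta> \<omega>) / L) \<le> K\<^sup>2 / (2 * c) * ?x" .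
    have "(\<Sum>u\<in>?U. v u * (v u + \<delta> \<omega>) / L) = (\<Sum>u\<in>?U. (v u)\<^sup>2 / L) + \<delta> \<omega> * (\<Sum>u\<in>?U. v u / L)"
      by (simp add: sum_distrib_left power2_eq_square distrib_left add_divide_distrib mult_ac flip: sum.distrib)
    \<comment> \<open>At least half of the total weight lies off the hubs, hence the factor 2 in
      \<open>D\<close>.\<close>
    moreover have "\<delta> \<omega> * (1 / 2) \<le> \<delta> \<omega> * (\<Sum>u\<in>?U. v u / L)" using mass \<delta>0 by (rule mult_left_mono)
    moreover have "\<delta> \<omega> * (1 / 2) = (K + 1 + K\<^sup>2 / (2 * c)) * (1 + \<eta> * \<omega> + sqrt \<omega>) * ?x"
    proof -
      have "2 * X * Y * Z * (1 / 2) = X * Y * Z" for X Y Z :: real by simp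
      then show ?thesis unfolding \<delta>_def D_def .
    qed
    \<comment> \<open>In units of the window, the left bracket collects the deficit from
      \<open>nu_lower\<close>, the second-order term of the edge probabilities, the budget, and the
      second-order term of the Laplace transform.\<close>
    moreover have "(K + K\<^sup>2 / (2 * c) + \<eta> * \<omega> + K / 2 * sqrt \<omega>) * ?x \<le>
        (K + 1 + K\<^sup>2 / (2 * c)) * (1 + \<eta> * \<omega> + sqrt \<omega>) * ?x"
    proof (rule mult_right_mono)
      define w where "w = \<eta> * \<omega>"
      define r where "r = sqrt \<omega>"
      define t where "t = K\<^sup>2 / (2 * c)"
      have "0 \<le> w" "0 \<le> r" "0 \<le> t" using pos \<eta> by (auto simp: w_def r_def t_def)
      then have "0 \<le> K * w" "0 \<le> t * w" "0 \<le> K * r" "0 \<le> t * r" "0 \<le> r" using pos by auto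
      then show "K + K\<^sup>2 / (2 * c) + \<eta> * \<omega> + K / 2 * sqrt \<omega> \<le>
          (K + 1 + K\<^sup>2 / (2 * c)) * (1 + \<eta> * \<omega> + sqrt \<omega>)"
        unfolding w_def[symmetric] r_def[symmetric] t_def[symmetric] by (simp add: algebra_simps)
    qed simp
    moreover have "(K + K\<^sup>2 / (2 * c) + \<eta> * \<omega> + K / 2 * sqrt \<omega>) * ?x =
        K * ?x + K\<^sup>2 / (2 * c) * ?x + d + K / 2 * sqrt \<omega> * ?x"
      by (simp only: d_def distrib_right)
    ultimately show ?thesis using a b nu_lower by linarith
  qed
  have "measure_pmf.prob (NR n v) {E. real (max_cluster_size n E) < n / A / \<omega>} \<le>
      exp (s * \<delta> \<omega> * (n / A / \<omega>) - s * v 1)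
      + K * A / (L * ?x * d) * (\<Sum>u\<in>?U. (v u)\<^sup>2 * (v u + \<delta> \<omega>) / L)"
    using nu_upper drift v_upper pos \<eta> \<delta>0 R n_ge
    by (intro max_cluster_lower_tail) (auto simp: s_def d_def)
  also have "\<dots> \<le> exp (2 * D) * (8 / c\<^sup>2) / \<omega> + K\<^sup>2 / (c * \<eta>) / \<omega>"
  proof (rule add_mono)
    define r where "r = sqrt \<omega>"
    have r: "1 < r" "\<omega> = r\<^sup>2" using \<omega> by (auto simp: r_def)
    have "s * \<delta> \<omega> * (n / A / \<omega>) = D * (1 + \<eta> * r\<^sup>2 + r) / r"
      using pos r by (simp add: s_def \<delta>_def flip: r_def) (simp add: r(2) power2_eq_square)
    also have "\<dots> = D * (1 / r) + D * \<eta> * r + D"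
      using r by (simp add: field_simps power2_eq_square)
    also have "D * \<eta> = c / 2" using D by (simp add: \<eta>_def)
    also have "D * (1 / r) \<le> D * 1" using r D by (intro mult_left_mono) auto
    finally have 1: "s * \<delta> \<omega> * (n / A / \<omega>) \<le> 2 * D + c / 2 * r" by simp
    have "s * (c * A) \<le> s * v 1" using v_hub pos by (intro mult_left_mono) (auto simp: s_def)
    then have 2: "c * r \<le> s * v 1" using pos by (simp add: s_def r_def mult_ac)
    define y where "y = c / 2 * r"
    have y: "0 < y" using r pos by (simp add: y_def)
    \<comment> \<open>As y is proportional to sqrt \<omega>, a quadratic bound on exp y already
      yields order 1/\<omega>.\<close>
    have "y\<^sup>2 / 2 \<le> exp y" using exp_lower_Taylor_quadratic[of y] y by linarith
    then have "exp (- y) \<le> 2 / y\<^sup>2" using y by (simp add: exp_minus field_simps)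
    also have "2 / y\<^sup>2 = 8 / c\<^sup>2 / \<omega>" using pos r by (simp add: y_def power_mult_distrib power_divide)
    finally have 3: "exp (- y) \<le> 8 / c\<^sup>2 / \<omega>" .
    have "s * \<delta> \<omega> * (n / A / \<omega>) - s * v 1 \<le> 2 * D - y"
      using 1 2 by (simp add: y_def)
    then have "exp (s * \<delta> \<omega> * (n / A / \<omega>) - s * v 1) \<le> exp (2 * D) * exp (- y)"
      by (simp flip: exp_add)
    also have "\<dots> \<le> exp (2 * D) * (8 / c\<^sup>2 / \<omega>)" using 3 by (intro mult_left_mono) auto
    finally show "exp (s * \<delta> \<omega> * (n / A / \<omega>) - s * v 1) \<le> exp (2 * D) * (8 / c\<^sup>2) / \<omega>" by simp
    have "K * A / (L * ?x * d) * (\<Sum>u\<in>?U. (v u)\<^sup>2 * (v u + \<delta> \<omega>) / L) \<le>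
        K * A / (c * n * ?x * d) * (K * (A ^ 3 / n))"
      using pos L_lower total_pos T2 T2_nonneg \<eta>
      by (intro mult_mono divide_left_mono mult_right_mono) (auto simp: d_def)
    also have "\<dots> = K\<^sup>2 / (c * \<eta>) / \<omega>"
      using pos \<eta> by (simp add: d_def power3_eq_cube power2_eq_square)
    finally show "K * A / (L * ?x * d) * (\<Sum>u\<in>?U. (v u)\<^sup>2 * (v u + \<delta> \<omega>) / L) \<le> K\<^sup>2 / (c * \<eta>) / \<omega>" .
  qed
  also have "\<dots> = (exp (2 * D) * (8 / c\<^sup>2) + K\<^sup>2 / (c * \<eta>)) / \<omega>"
    by (simp add: add_divide_distrib)
  finally show ?thesis .
qed

end

section \<open>Asymptotics of the weights\<close>

text \<open>The bound is required only inside the interval, so that the value of the integrand at 0,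
  where the quantile function may blow up, is irrelevant.\<close>

lemma const_le_integral:
  fixes f :: "real \<Rightarrow> real"
  assumes "f integrable_on {p..q}" "p \<le> q" "\<And>x. p < x \<Longrightarrow> x < q \<Longrightarrow> c \<le> f x"
  shows "c * (q - p) \<le> integral {p..q} f"
proof -
  have "c * (q - p) = integral {p<..<q} (\<lambda>_. c)"
    using assms(2) by (simp flip: integral_open_interval_real)
  also have "\<dots> \<le> integral {p<..<q} f"
    using assms by (intro integral_le) (auto simp: integrable_on_open_interval_real)
  finally show ?thesis by (simp add: integral_open_interval_real)
qed

lemma integral_le_const:
  fixes f :: "real \<Rightarrow> real"
  assumes "f integrable_on {p..q}" "p \<le> q" "\<And>x. p < x \<Longrightarrow> x < q \<Longrightarrow> f x \<le> c"
  shows "integral {p..q} f \<le> c * (q - p)"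
  using const_le_integral[of "\<lambda>x. - f x" p q "- c"] assms integrable_neg by (force simp: integral_neg)

text \<open>Each cell is compared with its right endpoint from below and its left endpoint from
  above. The first cell has no usable left endpoint, so its integral is kept as the error
  term.\<close>

lemma antimono_riemann_sum:
  fixes f :: "real \<Rightarrow> real" and n :: nat
  assumes int: "f integrable_on {0..1}" and n: "1 \<le> n"
    and anti: "\<And>x y. 0 < x \<Longrightarrow> x \<le> y \<Longrightarrow> y \<le> 1 \<Longrightarrow> f y \<le> f x"
  shows "(\<Sum>j=1..n. f (real j / real n)) / n \<le> integral {0..1} f"
    and "integral {0..1} f \<le> integral {0..1 / n} f + (\<Sum>j=1..<n. f (real j / real n)) / n"
proof -
  have int': "f integrable_on {p..q}" if "0 \<le> p" "q \<le> 1" for p q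
    using int that by (rule_tac integrable_subinterval_real) auto
  have *: "(\<Sum>j=1..k. f (real j / real n)) / n \<le> integral {0..k / n} f" if "k \<le> n" for k
    using that
  proof (induction k)
    case (Suc k)
    have "integral {0..Suc k / n} f = integral {0..k / n} f + integral {k / n..Suc k / n} f"
      using Suc.prems n by (intro Henstock_Kurzweil_Integration.integral_combine[symmetric] int')
        (auto simp: field_simps)
    moreover have "f (Suc k / n) * (Suc k / n - k / n) \<le> integral {k / n..Suc k / n} f"
      using Suc.prems n
      by (intro const_le_integral int' anti) (auto simp: field_simps intro: le_less_trans[of 0 "k / n"])
    moreover have "Suc k / n - k / n = 1 / real n" by (simp flip: diff_divide_distrib)
    ultimately show ?case using Suc by (simp add: add_divide_distrib)
  qed simp
  show "(\<Sum>j=1..n. f (real j / real n)) / n \<le> integral {0..1} f"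
    using *[of n] n by simp
  have **: "integral {0..Suc k / n} f \<le> integral {0..1 / n} f + (\<Sum>j=1..<Suc k. f (real j / real n)) / n" if "k < n" for k
    using that
  proof (induction k)
    case (Suc k)
    let ?k = "Suc k"
    have "integral {0..Suc ?k / n} f = integral {0..?k / n} f + integral {?k / n..Suc ?k / n} f"
      using Suc.prems n by (intro Henstock_Kurzweil_Integration.integral_combine[symmetric] int')
        (auto simp: field_simps)
    moreover have "integral {?k / n..Suc ?k / n} f \<le> f (?k / n) * (Suc ?k / n - ?k / n)"
    proof (intro integral_le_const int')
      have le: "0 < ?k / n" "Suc ?k / n \<le> 1" using Suc.prems n by auto
      then show "Suc ?k / real n \<le> 1" by simp
      show "f x \<le> f (?k / n)" if "?k / n < x" "x < Suc ?k / n" for x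
        using that le by (intro anti) auto
    qed (auto simp: divide_right_mono)
    moreover have "Suc ?k / n - ?k / n = 1 / real n" by (simp flip: diff_divide_distrib)
    ultimately show ?case using Suc by (simp add: add_divide_distrib)
  qed simp
  show "integral {0..1} f \<le> integral {0..1 / n} f + (\<Sum>j=1..<n. f (real j / real n)) / n"
    using **[of "n - 1"] n by simp
qed

section \<open>The quantile function of a power-law weight\<close>

locale heavy_tailed =
  fixes M :: "'a measure" and W :: "'a \<Rightarrow> real" and F :: "real \<Rightarrow> real" and \<tau> c\<^sub>F :: real
  assumes prob: "prob_space M"
    and W_meas: "W \<in> borel_measurable M"
    and W_nonneg: "AE x in M. 0 \<le> W x"
    and F_eq: "F = cdf (distr M borel W)"
    and nu: "prob_space.expectation M (\<lambda>x. (W x)\<^sup>2) / prob_space.expectation M W = 1"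
    and tau: "3 < \<tau>" "\<tau> < 4"
    and cF: "0 < c\<^sub>F"
    and tail: "((\<lambda>x. x powr (\<tau> - 1) * (1 - F x)) \<longlongrightarrow> c\<^sub>F) at_top"
begin

sublocale prob_space M by (rule prob)

sublocale D: cdf_distribution "distr M borel W"
  unfolding cdf_distribution_def using W_meas by (rule real_distribution_distr)

definition \<alpha> :: real where "\<alpha> = 1 / (\<tau> - 1)"

lemma alpha: "1 / 3 < \<alpha>" "\<alpha> < 1 / 2" "(\<tau> - 1) * \<alpha> = 1"
  using tau by (auto simp: \<alpha>_def field_simps)

definition Q :: "real \<Rightarrow> real" where "Q u = gen_inverse F u"

lemma Q_eq_I: "u \<noteq> 1 \<Longrightarrow> Q u = D.I (1 - u)"
  by (simp add: Q_def gen_inverse_def algebra_simps flip: F_eq)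

text \<open>The Galois connection between quantile and distribution function, through which tail
  estimates for \<open>F\<close> become estimates for \<open>Q\<close>.\<close>

lemma Q_le_iff:
  assumes "0 < u" "u < 1"
  shows "Q u \<le> x \<longleftrightarrow> 1 - F x \<le> u"
  using D.pseudoinverse[of "1 - u" x] assms by (auto simp: Q_eq_I simp flip: F_eq)

lemma Q_1: "Q 1 = 0"
  by (simp add: Q_def gen_inverse_def)

lemma F_neg: "x < 0 \<Longrightarrow> F x = 0"
proof -
  assume "x < 0"
  have "F x = measure M {y \<in> space M. W y \<le> x}"
    unfolding F_eq cdf_def using W_meas by (subst measure_distr) (auto intro!: arg_cong[where f = prob])
  also have "\<dots> = 0"
    using W_nonneg \<open>x < 0\<close> W_meas by (intro prob_eq_0_AE) (auto elim!: eventually_mono)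
  finally show ?thesis .
qed

lemma Q_nonneg: "0 < u \<Longrightarrow> u \<le> 1 \<Longrightarrow> 0 \<le> Q u"
  using Q_le_iff[of u "Q u"] F_neg[of "Q u"] Q_1 by (cases "u = 1") force+

lemma Q_antimono: "0 < u \<Longrightarrow> u \<le> u' \<Longrightarrow> u' \<le> 1 \<Longrightarrow> Q u' \<le> Q u"
  using Q_le_iff[of u "Q u"] Q_le_iff[of u' "Q u"] Q_1 Q_nonneg[of u] by (cases "u' = 1"; cases "u = 1") auto

lemma F_nonneg: "0 \<le> F x"
  unfolding F_eq by (rule D.cdf_nonneg)

lemma powr_tail_inverse:
  assumes "0 < y"
  shows "(y powr \<alpha>) powr - (\<tau> - 1) = 1 / y"
proof -
  have "\<alpha> * (1 - \<tau>) = -1" using alpha(3) by (simp add: algebra_simps)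
  then show ?thesis using assms by (simp add: powr_powr powr_minus_divide)
qed

text \<open>The tail bound holds for large x and extends to all x > 0 with a larger constant
  \<open>C0\<close>. At x = (C0/u)^\<alpha> it says that the tail is at most u.\<close>

lemma Q_upper: "\<exists>C>0. \<forall>u. 0 < u \<longrightarrow> u \<le> 1 \<longrightarrow> Q u \<le> C * u powr - \<alpha>"
proof -
  have "\<forall>\<^sub>F x in at_top. x powr (\<tau> - 1) * (1 - F x) < c\<^sub>F + 1"
    using tail by (rule order_tendstoD) simp
  then obtain x0 where x0: "\<And>x. x \<ge> x0 \<Longrightarrow> x powr (\<tau> - 1) * (1 - F x) < c\<^sub>F + 1"
    by (auto simp: eventually_at_top_linorder)
  define C0 where "C0 = max (c\<^sub>F + 1) (\<bar>x0\<bar> powr (\<tau> - 1))"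
  have C0: "0 < C0" using cF by (auto simp: C0_def)
  have C0_tail: "1 - F x \<le> C0 * x powr - (\<tau> - 1)" if "0 < x" for x
  proof -
    have "x powr (\<tau> - 1) * (1 - F x) \<le> C0"
    proof (cases "x \<ge> x0")
      case True
      then show ?thesis using x0[of x] by (auto simp: C0_def)
    next
      case False
      have "x powr (\<tau> - 1) * (1 - F x) \<le> x powr (\<tau> - 1) * 1"
        using F_nonneg[of x] by (intro mult_left_mono) auto
      also have "\<dots> \<le> \<bar>x0\<bar> powr (\<tau> - 1)"
        using False that tau by (auto intro!: powr_mono2)
      finally show ?thesis by (simp add: C0_def)
    qed
    then show ?thesis
      unfolding powr_minus_divide using that by (simp add: pos_le_divide_eq mult.commute)
  qed
  have "Q u \<le> C0 powr \<alpha> * u powr - \<alpha>" if u: "0 < u" "u \<le> 1" for u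
  proof (cases "u = 1")
    case False
    have "1 - F ((C0 / u) powr \<alpha>) \<le> C0 * ((C0 / u) powr \<alpha>) powr - (\<tau> - 1)"
      using C0 u by (intro C0_tail) auto
    also have "\<dots> = u" using C0 u by (subst powr_tail_inverse) auto
    finally have "Q u \<le> (C0 / u) powr \<alpha>"
      using Q_le_iff False u by auto
    then show ?thesis using C0 u by (simp add: powr_divide powr_minus_divide)
  qed (simp add: Q_1)
  then show ?thesis using C0 by (intro exI[of _ "C0 powr \<alpha>"]) auto
qed

text \<open>At x = (c/u)^\<alpha>, with c half the tail constant, the tail exceeds u as soon as x is
  beyond the range where the asymptotics hold, that is, for small u. The cap 1/2 keeps u away from
  the conventional value at 1.\<close>

lemma Q_lower: "\<exists>c>0. \<exists>u\<^sub>0>0. \<forall>u. 0 < u \<longrightarrow> u \<le> u\<^sub>0 \<longrightarrow> c * u powr - \<alpha> \<le> Q u"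
proof -
  have "\<forall>\<^sub>F x in at_top. c\<^sub>F / 2 < x powr (\<tau> - 1) * (1 - F x)"
    using tail by (rule order_tendstoD) (use cF in simp)
  then obtain x1 where x1: "\<And>x. x \<ge> x1 \<Longrightarrow> c\<^sub>F / 2 < x powr (\<tau> - 1) * (1 - F x)"
    by (auto simp: eventually_at_top_linorder)
  define x0 where "x0 = max x1 1"
  define u0 where "u0 = min (1 / 2) (c\<^sub>F / 2 * x0 powr - (\<tau> - 1))"
  have x0: "0 < x0" by (simp add: x0_def)
  have u0: "0 < u0" "u0 < 1" using cF x0 by (auto simp: u0_def)
  have "(c\<^sub>F / 2) powr \<alpha> * u powr - \<alpha> \<le> Q u" if u: "0 < u" "u \<le> u0" for u
  proof -
    define y where "y = c\<^sub>F / 2 / u"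
    have y: "0 < y" using cF u by (simp add: y_def)
    have "x0 powr (\<tau> - 1) \<le> y"
    proof -
      have "u \<le> c\<^sub>F / 2 * x0 powr - (\<tau> - 1)" using u by (simp add: u0_def)
      also have "x0 powr - (\<tau> - 1) = 1 / x0 powr (\<tau> - 1)" by (rule powr_minus_divide)
      finally show ?thesis using u x0 by (simp add: y_def field_simps)
    qed
    then have "(x0 powr (\<tau> - 1)) powr \<alpha> \<le> y powr \<alpha>"
      using alpha by (intro powr_mono2) auto
    then have "x0 \<le> y powr \<alpha>" using alpha(3) x0 by (simp add: powr_powr)
    then have "c\<^sub>F / 2 < (y powr \<alpha>) powr (\<tau> - 1) * (1 - F (y powr \<alpha>))"
      by (intro x1) (simp add: x0_def)
    also have "(y powr \<alpha>) powr (\<tau> - 1) = y"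
      using alpha(3) y by (simp add: powr_powr mult.commute)
    finally have "y * u < y * (1 - F (y powr \<alpha>))"
      using u by (simp add: y_def)
    then have "u < 1 - F (y powr \<alpha>)"
      using y by simp
    then have "y powr \<alpha> \<le> Q u"
      using Q_le_iff[of u "y powr \<alpha>"] u u0 by force
    then show ?thesis using u cF by (simp add: y_def powr_divide powr_mult powr_minus_divide)
  qed
  then show ?thesis using u0 cF by (intro exI[of _ "(c\<^sub>F / 2) powr \<alpha>"] conjI exI[of _ u0]) auto
qed

section \<open>Moments and power sums of the weights\<close>

definition \<mu> :: real where "\<mu> = expectation W"

text \<open>A non-integrable function has expectation 0 and division by 0 gives 0, so a ratio equal
  to 1 already forces both moments to be finite and nonzero.\<close>

lemma moments:
  shows "0 < \<mu>" "integrable M W" "integrable M (\<lambda>x. (W x)\<^sup>2)" "expectation (\<lambda>x. (W x)\<^sup>2) = \<mu>"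
proof -
  have ne: "expectation W \<noteq> 0" "expectation (\<lambda>x. (W x)\<^sup>2) \<noteq> 0"
    using nu by auto
  then show "integrable M W" "integrable M (\<lambda>x. (W x)\<^sup>2)"
    using not_integrable_integral_eq by blast+
  show "expectation (\<lambda>x. (W x)\<^sup>2) = \<mu>"
    using nu ne by (simp add: \<mu>_def)
  have "0 \<le> expectation W" using W_nonneg by (rule integral_nonneg_AE)
  then show "0 < \<mu>" using ne by (simp add: \<mu>_def)
qed

text \<open>Inverse transform sampling: the quantile function at a uniform variable has the law of
  \<open>W\<close>. The reflection w -> 1 - w passes from \<open>D.I\<close> to \<open>Q\<close>,
  and the value at 0 is set to 0.\<close>

lemma quantile_moment:
  assumes p: "0 < p" and int: "integrable M (\<lambda>x. W x ^ p)"
  shows "((\<lambda>u. if 0 < u then Q u ^ p else 0) has_integral expectation (\<lambda>x. W x ^ p)) {0..1}"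
proof -
  let ?\<Omega> = "restrict_space lborel {0<..<1::real}"
  have meas: "D.I \<in> measurable ?\<Omega> borel"
    using D.measurable_CI by (simp add: measurable_def sets_restrict_space space_restrict_space)
  have "integrable (distr M borel W) (\<lambda>x. x ^ p)"
    using int W_meas by (subst integrable_distr_eq) auto
  then have 1: "integrable ?\<Omega> (\<lambda>w. D.I w ^ p)"
    by (subst (asm) D.distr_I_eq_M[symmetric], subst (asm) integrable_distr_eq) (use meas in auto)
  have "expectation (\<lambda>x. W x ^ p) = integral\<^sup>L (distr M borel W) (\<lambda>x. x ^ p)"
    using W_meas by (subst integral_distr) auto
  also have "\<dots> = integral\<^sup>L ?\<Omega> (\<lambda>w. D.I w ^ p)"
    by (subst D.distr_I_eq_M[symmetric], subst integral_distr) (use meas in auto)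
  finally have 2: "integral\<^sup>L ?\<Omega> (\<lambda>w. D.I w ^ p) = expectation (\<lambda>x. W x ^ p)" ..
  define G where "G = (\<lambda>w::real. indicator {0<..<1} w * D.I w ^ p)"
  have 3: "integrable lborel G" "integral\<^sup>L lborel G = expectation (\<lambda>x. W x ^ p)"
    using 1 2 by (simp_all add: G_def integrable_restrict_space integral_restrict_space)
  have "integrable lborel (\<lambda>x. G (1 + -1 * x))"
    using 3(1) by (rule lborel_integrable_real_affine) simp
  moreover have "integral\<^sup>L lborel (\<lambda>x. G (1 + -1 * x)) = expectation (\<lambda>x. W x ^ p)"
    using lborel_integral_real_affine[of "-1" G 1] 3(2) by simp
  ultimately have "((\<lambda>x. G (1 + -1 * x)) has_integral expectation (\<lambda>x. W x ^ p)) UNIV"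
    using has_integral_integral_lborel by metis
  then have "((\<lambda>x. if x \<in> {0..1} then (if 0 < x then Q x ^ p else 0) else 0) has_integral expectation (\<lambda>x. W x ^ p)) UNIV"
    by (rule has_integral_eq[rotated]) (use p in \<open>auto simp: G_def indicator_def Q_eq_I Q_1\<close>)
  then show ?thesis by (simp only: has_integral_restrict_UNIV)
qed

lemma weight_eq: "weight F n j = Q (j / n)"
  by (simp add: weight_def Q_def)

lemma weight_nonneg: "j \<in> {1..n} \<Longrightarrow> 0 \<le> weight F n j"
  unfolding weight_eq by (rule Q_nonneg) auto

text \<open>The sum is a right-endpoint Riemann sum of a decreasing function, so it never exceeds
  the moment. It falls short by at most the first cell, which \<open>Q_upper\<close> bounds because
  p \<alpha> < 1.\<close>

lemma weight_power_sum:
  assumes p: "0 < p" "p * \<alpha> < 1" and int: "integrable M (\<lambda>x. W x ^ p)"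
  shows "\<exists>C\<ge>0. \<forall>n\<ge>1. expectation (\<lambda>x. W x ^ p) * n - C * n powr (p * \<alpha>) \<le> (\<Sum>j=1..n. weight F n j ^ p) \<and>
    (\<Sum>j=1..n. weight F n j ^ p) \<le> expectation (\<lambda>x. W x ^ p) * n"
proof -
  define f where "f u = (if 0 < u then Q u ^ p else 0)" for u
  note hi = quantile_moment[OF p(1) int, folded f_def]
  obtain C where C: "0 < C" "\<And>u. 0 < u \<Longrightarrow> u \<le> 1 \<Longrightarrow> Q u \<le> C * u powr - \<alpha>"
    using Q_upper by blast
  define C' where "C' = C ^ p / (1 - p * \<alpha>)"
  have C': "0 \<le> C'" using C p by (simp add: C'_def)
  have anti: "f y \<le> f x" if "0 < x" "x \<le> y" "y \<le> 1" for x y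
    using that Q_antimono Q_nonneg by (auto simp: f_def intro!: power_mono)
  have "expectation (\<lambda>x. W x ^ p) * n - C' * n powr (p * \<alpha>) \<le> (\<Sum>j=1..n. weight F n j ^ p) \<and>
    (\<Sum>j=1..n. weight F n j ^ p) \<le> expectation (\<lambda>x. W x ^ p) * n" if n: "1 \<le> n" for n :: nat
  proof
    have R: "(\<Sum>j=1..n. f (real j / real n)) / n \<le> expectation (\<lambda>x. W x ^ p)"
      "expectation (\<lambda>x. W x ^ p) \<le> integral {0..1 / n} f + (\<Sum>j=1..<n. f (real j / real n)) / n"
      using antimono_riemann_sum[OF has_integral_integrable[OF hi] n, unfolded integral_unique[OF hi]] anti
      by blast+
    have S: "(\<Sum>j=1..n. weight F n j ^ p) = (\<Sum>j=1..n. f (real j / real n))"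
      by (intro sum.cong) (auto simp: weight_eq f_def)
    show "(\<Sum>j=1..n. weight F n j ^ p) \<le> expectation (\<lambda>x. W x ^ p) * n"
      unfolding S using R(1) n by (simp add: field_simps)
    have int: "integral {0..1 / n} f \<le> C' * n powr (p * \<alpha> - 1)"
    proof -
      have "((\<lambda>x. C ^ p * x powr (- (p * \<alpha>))) has_integral
          C ^ p * ((1 / n) powr (- (p * \<alpha>) + 1) / (- (p * \<alpha>) + 1))) {0..1 / n}"
        using p n by (intro has_integral_mult_right has_integral_powr_from_0) auto
      moreover have "f integrable_on {0..1 / n}"
        using has_integral_integrable[OF hi] by (rule integrable_subinterval_real) (use n in auto)
      moreover have "f x \<le> C ^ p * x powr (- (p * \<alpha>))" if "x \<in> {0..1 / n}" for x
      proof (cases "x = 0")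
        case False
        have "1 / real n \<le> 1" using n by simp
        then have "x \<le> 1" using that by (auto intro: order_trans)
        then have "Q x ^ p \<le> (C * x powr - \<alpha>) ^ p"
          using that False C Q_nonneg by (intro power_mono) auto
        also have "\<dots> = C ^ p * x powr (- (p * \<alpha>))"
          using that False by (simp add: power_mult_distrib powr_powr mult.commute flip: powr_realpow)
        finally show ?thesis using that False by (simp add: f_def)
      qed (simp add: f_def)
      ultimately have "integral {0..1 / n} f \<le> C ^ p * ((1 / n) powr (- (p * \<alpha>) + 1) / (- (p * \<alpha>) + 1))"
        by (intro has_integral_le[OF integrable_integral]) auto
      also have "(1 / real n) powr (- (p * \<alpha>) + 1) = n powr (p * \<alpha> - 1)"
        using n by (simp add: powr_divide flip: powr_minus_divide)
      finally show ?thesis by (simp add: C'_def)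
    qed
    \<comment> \<open>The convention \<open>Q 1 = 0\<close> makes the summand j = n vanish, so both
      Riemann bounds involve the same sum.\<close>
    have S': "(\<Sum>j=1..<n. f (real j / real n)) = (\<Sum>j=1..n. f (real j / real n))"
    proof -
      have "f (n / n) = 0" using n p by (simp add: f_def Q_1)
      moreover have "{1..n} = insert n {1..<n}" using n by auto
      ultimately show ?thesis by simp
    qed
    have "expectation (\<lambda>x. W x ^ p) \<le> C' * n powr (p * \<alpha> - 1) + (\<Sum>j=1..n. f (real j / real n)) / n"
      using R(2) int unfolding S' by linarith
    then have "expectation (\<lambda>x. W x ^ p) * n \<le> (C' * n powr (p * \<alpha> - 1) + (\<Sum>j=1..n. f (real j / real n)) / n) * n"
      by (rule mult_right_mono) simp
    also have "\<dots> = C' * n powr (p * \<alpha>) + (\<Sum>j=1..n. f (real j / real n))"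
      using n by (simp add: distrib_right powr_diff)
    finally show "expectation (\<lambda>x. W x ^ p) * n - C' * n powr (p * \<alpha>) \<le> (\<Sum>j=1..n. weight F n j ^ p)"
      unfolding S by simp
  qed
  then show ?thesis using C' by blast
qed

end

section \<open>Third powers, number of hubs, and the window conditions\<close>

context heavy_tailed
begin

text \<open>Since 3 \<alpha> > 1, the series of j^(-3 \<alpha>) converges: the heaviest weights
  dominate, and the order is n^(3 \<alpha>) instead of n.\<close>

lemma weight_cube_sum: "\<exists>C\<ge>0. \<forall>n\<ge>1. (\<Sum>j=1..n. weight F n j ^ 3) \<le> C * (n powr \<alpha>) ^ 3"
proof -
  obtain C where C: "0 < C" "\<And>u. 0 < u \<Longrightarrow> u \<le> 1 \<Longrightarrow> Q u \<le> C * u powr - \<alpha>"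
    using Q_upper by blast
  have summable: "summable (\<lambda>j. real j powr - (3 * \<alpha>))"
    using alpha by (simp add: summable_real_powr_iff)
  define Z where "Z = (\<Sum>j. real j powr - (3 * \<alpha>))"
  have Z: "0 \<le> Z" unfolding Z_def using summable by (intro suminf_nonneg) auto
  have "(\<Sum>j=1..n. weight F n j ^ 3) \<le> C ^ 3 * Z * (n powr \<alpha>) ^ 3" if n: "1 \<le> n" for n :: nat
  proof -
    have "(\<Sum>j=1..n. weight F n j ^ 3) \<le> (\<Sum>j=1..n. C ^ 3 * (n powr \<alpha>) ^ 3 * real j powr - (3 * \<alpha>))"
    proof (rule sum_mono)
      fix j assume j: "j \<in> {1..n}"
      have "weight F n j \<le> C * (j / n) powr - \<alpha>"
        unfolding weight_eq using j by (intro C) auto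
      also have "\<dots> = C * (n powr \<alpha> * real j powr - \<alpha>)"
        using j n by (simp add: powr_divide powr_minus_divide)
      finally have "weight F n j ^ 3 \<le> (C * (n powr \<alpha> * real j powr - \<alpha>)) ^ 3"
        using weight_nonneg[OF j] by (rule power_mono)
      also have "(real j powr - \<alpha>) ^ 3 = real j powr - (3 * \<alpha>)"
        using j by (simp add: powr_powr mult.commute flip: powr_realpow)
      then have "(C * (n powr \<alpha> * real j powr - \<alpha>)) ^ 3 = C ^ 3 * (n powr \<alpha>) ^ 3 * real j powr - (3 * \<alpha>)"
        by (simp add: power_mult_distrib)
      finally show "weight F n j ^ 3 \<le> C ^ 3 * (n powr \<alpha>) ^ 3 * real j powr - (3 * \<alpha>)" .
    qed
    also have "\<dots> = C ^ 3 * (n powr \<alpha>) ^ 3 * (\<Sum>j=1..n. real j powr - (3 * \<alpha>))"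
      by (simp add: sum_distrib_left)
    also have "\<dots> \<le> C ^ 3 * (n powr \<alpha>) ^ 3 * Z"
      unfolding Z_def using C summable by (intro mult_left_mono sum_le_suminf) auto
    finally show ?thesis by (simp add: mult_ac)
  qed
  then show ?thesis using C Z by (intro exI[of _ "C ^ 3 * Z"]) auto
qed

lemma window_tendsto_0: "(\<lambda>n. (real n powr \<alpha>)\<^sup>2 / real n) \<longlonglongrightarrow> 0"
proof -
  have "(\<lambda>n. real n powr (2 * \<alpha> - 1)) \<longlonglongrightarrow> 0"
    using alpha by (intro tendsto_neg_powr filterlim_real_sequentially) auto
  moreover have "\<forall>\<^sub>F n in sequentially. real n powr (2 * \<alpha> - 1) = (real n powr \<alpha>)\<^sup>2 / real n"
    using eventually_gt_at_top[of 0]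
    by eventually_elim (simp add: powr_diff powr_powr mult.commute flip: powr_realpow)
  ultimately show ?thesis by (simp cong: tendsto_cong add: filterlim_cong[OF refl refl])
qed

lemma hub_count:
  assumes "0 < c" "0 < \<kappa>"
  shows "\<exists>R\<ge>1. \<kappa> \<le> c * real R powr (1 - 2 * \<alpha>)"
proof -
  have "(\<lambda>R. real R powr (2 * \<alpha> - 1)) \<longlonglongrightarrow> 0"
    using alpha by (intro tendsto_neg_powr filterlim_real_sequentially) auto
  then have "\<forall>\<^sub>F R in sequentially. real R powr (2 * \<alpha> - 1) < c / \<kappa>"
    using assms by (intro order_tendstoD) auto
  then have "\<forall>\<^sub>F R in sequentially. real R powr (2 * \<alpha> - 1) < c / \<kappa> \<and> 1 \<le> R"
    using eventually_ge_at_top[of 1] by eventually_elim simp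
  then obtain R where R: "1 \<le> R" "real R powr (2 * \<alpha> - 1) < c / \<kappa>"
    by (auto dest: eventually_happens)
  have "real R powr (1 - 2 * \<alpha>) = 1 / real R powr (2 * \<alpha> - 1)"
    using powr_minus_divide[of "real R" "2 * \<alpha> - 1"] by simp
  moreover have "\<kappa> \<le> c * (1 / real R powr (2 * \<alpha> - 1))"
    using R assms by (simp add: field_simps)
  ultimately have "\<kappa> \<le> c * real R powr (1 - 2 * \<alpha>)"
    by simp
  with R show ?thesis by blast
qed

text \<open>\<open>R\<close>, \<open>K\<close> and \<open>c\<close> are chosen before n, and the
  threshold for n is uniform in e. This is what makes the final constant depend only on \<Lambda>
  and \<open>F\<close>.\<close>

lemma critical_weights_eventually:
  fixes \<Lambda> :: real
  assumes \<Lambda>: "0 < \<Lambda>"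
  shows "\<exists>R K c. \<forall>\<^sub>F n in sequentially. \<forall>e. \<bar>e\<bar> \<le> \<Lambda> * ((n powr \<alpha>)\<^sup>2 / n) \<longrightarrow>
    critical_weights n (\<lambda>j. (1 + e) * weight F n j) R (n powr \<alpha>) K c"
proof -
  obtain C where C: "0 < C" "\<And>u. 0 < u \<Longrightarrow> u \<le> 1 \<Longrightarrow> Q u \<le> C * u powr - \<alpha>"
    using Q_upper by blast
  obtain c\<^sub>0 u\<^sub>0 where c0: "0 < c\<^sub>0" "0 < u\<^sub>0" "\<And>u. 0 < u \<Longrightarrow> u \<le> u\<^sub>0 \<Longrightarrow> c\<^sub>0 * u powr - \<alpha> \<le> Q u"
    using Q_lower by blast
  obtain C1 where C1: "0 \<le> C1" "\<And>n. 1 \<le> n \<Longrightarrow> \<mu> * n - C1 * n powr \<alpha> \<le> (\<Sum>j=1..n. weight F n j)"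
      "\<And>n. 1 \<le> n \<Longrightarrow> (\<Sum>j=1..n. weight F n j) \<le> \<mu> * n"
    using weight_power_sum[of 1] alpha moments by (auto simp: \<mu>_def)
  obtain C2 where C2: "0 \<le> C2" "\<And>n. 1 \<le> n \<Longrightarrow> \<mu> * n - C2 * (n powr \<alpha>)\<^sup>2 \<le> (\<Sum>j=1..n. (weight F n j)\<^sup>2)"
      "\<And>n. 1 \<le> n \<Longrightarrow> (\<Sum>j=1..n. (weight F n j)\<^sup>2) \<le> \<mu> * n"
  proof -
    have "(n powr \<alpha>)\<^sup>2 = n powr (2 * \<alpha>)" if "1 \<le> n" for n :: nat
      using that by (simp add: powr_powr mult.commute flip: powr_realpow)
    then show thesis
      using that weight_power_sum[of 2] alpha moments by auto
  qed
  obtain C3 where C3: "0 \<le> C3" "\<And>n. 1 \<le> n \<Longrightarrow> (\<Sum>j=1..n. weight F n j ^ 3) \<le> C3 * (n powr \<alpha>) ^ 3"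
    using weight_cube_sum by blast
  note mu = moments(1)
  \<comment> \<open>What the hubs must remove, in units of the window: \<Lambda> \<mu> against the
    factor 1 + e, \<open>C1\<close> against the shortfall of the total weight, and \<mu> for the
    margin itself.\<close>
  define \<kappa> where "\<kappa> = \<Lambda> * \<mu> + C1 + \<mu>"
  have \<kappa>: "0 < \<kappa>" using \<Lambda> mu C1 by (simp add: \<kappa>_def add_pos_nonneg)
  obtain R where R: "1 \<le> R" "\<kappa> \<le> c\<^sub>0\<^sup>2 * real R powr (1 - 2 * \<alpha>)"
    using hub_count[of "c\<^sub>0\<^sup>2" \<kappa>] c0 \<kappa> by auto
  \<comment> \<open>The deficit of \<open>nu_lower\<close> has three sources: the factor 1 + e, the
    Riemann error \<open>C2\<close>, and the \<open>R\<close> deleted squares.\<close>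
  define K1 where "K1 = \<Lambda> + (C2 + R * C\<^sup>2) / \<mu>"
  define K2 where "K2 = 16 * (C3 + \<mu>) / \<mu>"
  define K where "K = 1 + 3 / 2 * C + 3 / 2 * \<mu> + K1 + K2"
  define c where "c = min (c\<^sub>0 / 2) (\<mu> / 4)"
  have K12: "0 \<le> K1" "0 \<le> K2" using \<Lambda> mu C1 C2 C3 C by (auto simp: K1_def K2_def)
  have K: "1 \<le> K" "3 / 2 * C \<le> K" "3 / 2 * \<mu> \<le> K" "K1 \<le> K" "K2 \<le> K"
    using K12 C mu by (auto simp: K_def)
  have c: "0 < c" using c0 mu by (simp add: c_def)
  have small: "\<forall>\<^sub>F n in sequentially. (real n powr \<alpha>)\<^sup>2 / real n < z" if "0 < z" for z
    using order_tendstoD(2)[OF window_tendsto_0 that] .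
  \<comment> \<open>These thresholds on the window width give in turn |e| <= 1/2, a total weight of
    at least \<mu> n / 2, and hubs carrying at most half of it.\<close>
  have pos: "0 < 1 / (2 * \<Lambda>)" "0 < \<mu> / (2 * (C1 + 1))" "0 < \<mu> / (4 * real R * C)"
    using \<Lambda> mu C1 C R by auto
  have "\<forall>\<^sub>F n in sequentially. \<forall>e. \<bar>e\<bar> \<le> \<Lambda> * ((n powr \<alpha>)\<^sup>2 / n) \<longrightarrow>
      critical_weights n (\<lambda>j. (1 + e) * weight F n j) R (n powr \<alpha>) K c"
    using small[OF pos(1)] small[OF pos(2)] small[OF pos(3)] small[OF zero_less_one]
      eventually_ge_at_top[of "max R (nat \<lceil>R / u\<^sub>0\<rceil>)"]
  proof eventually_elim
    case (elim n)
    define A where "A = real n powr \<alpha>"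
    define y where "y = A\<^sup>2 / n"
    let ?w = "weight F n"
    let ?U = "{1..n} - {1..R}"
    define S1 where "S1 = (\<Sum>j=1..n. ?w j)"
    define S2 where "S2 = (\<Sum>j\<in>?U. (?w j)\<^sup>2)"
    have n: "1 \<le> n" "R \<le> n" "1 \<le> real n" using elim R by auto
    \<comment> \<open>Puts all hubs in the range where \<open>Q_lower\<close> applies.\<close>
    have nu0: "R / n \<le> u\<^sub>0"
    proof -
      have "R / u\<^sub>0 \<le> n" using elim by (simp add: nat_le_iff ceiling_le_iff)
      then show ?thesis using c0 n by (simp add: field_simps)
    qed
    have A1: "1 \<le> A" using n alpha by (auto simp: A_def intro: ge_one_powr_ge_zero)
    have A_sq: "A \<le> A\<^sup>2" using A1 self_le_power[of A 2] by auto
    have y0: "0 < y" using A1 n by (simp add: y_def)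
    have A2: "A\<^sup>2 = y * n" using n by (simp add: y_def)
    have y_bounds: "\<Lambda> * y \<le> 1 / 2" "C1 * y \<le> \<mu> / 2" "R * C * y \<le> \<mu> / 4" "y \<le> 1"
    proof -
      show "\<Lambda> * y \<le> 1 / 2" using elim(1) \<Lambda> by (simp add: y_def A_def field_simps)
      have "y * (2 * (C1 + 1)) \<le> \<mu>"
        using elim(2) C1 by (simp add: y_def A_def pos_less_divide_eq less_imp_le)
      then show "C1 * y \<le> \<mu> / 2" using y0 by (simp add: algebra_simps)
      have "y * (4 * R * C) \<le> \<mu>"
        using elim(3) C R by (simp add: y_def A_def pos_less_divide_eq less_imp_le)
      then show "R * C * y \<le> \<mu> / 4" by (simp add: mult_ac)
      show "y \<le> 1" using elim(4) by (simp add: y_def A_def)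
    qed
    have A3: "real n \<le> A ^ 3"
    proof -
      have "n powr 1 \<le> n powr (3 * \<alpha>)" using n alpha by (intro powr_mono) auto
      then show ?thesis using n by (simp add: A_def powr_powr mult.commute flip: powr_realpow)
    qed
    have w0: "0 \<le> ?w j" if "j \<in> {1..n}" for j using weight_nonneg that .
    have w_upper: "?w j \<le> C * A" if j: "j \<in> {1..n}" for j
    proof -
      have "?w j \<le> C * (j / n) powr - \<alpha>" unfolding weight_eq using j by (intro C) auto
      also have "\<dots> \<le> C * (1 / n) powr - \<alpha>"
        using j C alpha n by (intro mult_left_mono powr_mono2') (auto simp: divide_right_mono)
      also have "(1 / real n) powr - \<alpha> = A" using n by (simp add: A_def powr_divide powr_minus_divide)
      finally show ?thesis .
    qed
    have w_lower: "c\<^sub>0 * A * real R powr - \<alpha> \<le> ?w j" and w_lower': "c\<^sub>0 * A * real j powr - \<alpha> \<le> ?w j"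
      if j: "j \<in> {1..R}" for j
    proof -
      have "j / n \<le> R / n" using j by (auto intro: divide_right_mono)
      then have "c\<^sub>0 * (j / n) powr - \<alpha> \<le> ?w j"
        unfolding weight_eq using j n nu0 by (intro c0) auto
      also have "c\<^sub>0 * (j / n) powr - \<alpha> = c\<^sub>0 * A * real j powr - \<alpha>"
        using n j by (simp add: A_def powr_divide powr_minus_divide)
      finally show *: "c\<^sub>0 * A * real j powr - \<alpha> \<le> ?w j" .
      have "c\<^sub>0 * A * real R powr - \<alpha> \<le> c\<^sub>0 * A * real j powr - \<alpha>"
        using j c0 A1 alpha by (intro mult_left_mono powr_mono2') auto
      with * show "c\<^sub>0 * A * real R powr - \<alpha> \<le> ?w j" by linarith
    qed
    have S1_upper: "S1 \<le> \<mu> * n" using C1(3)[OF n(1)] by (simp add: S1_def)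
    have S1_lower: "(\<mu> - C1 * y) * n \<le> S1"
    proof -
      have "C1 * A \<le> C1 * A\<^sup>2" using A_sq C1(1) by (rule mult_left_mono)
      then show ?thesis using C1(2)[OF n(1)] A2 by (simp add: S1_def A_def[symmetric] algebra_simps)
    qed
    have S1_half: "\<mu> / 2 * n \<le> S1"
    proof -
      have "\<mu> / 2 * n \<le> (\<mu> - C1 * y) * n" using y_bounds by (intro mult_right_mono) auto
      then show ?thesis using S1_lower by linarith
    qed
    have S10: "0 < S1" using S1_half mu n by (smt (verit) mult_pos_pos half_gt_zero)
    have split: "(\<Sum>j=1..n. f j) = (\<Sum>j\<in>?U. f j) + (\<Sum>j=1..R. f j)" for f :: "nat \<Rightarrow> real"
      using n by (subst sum.subset_diff[of "{1..R}"]) auto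
    have S2_0: "0 \<le> S2" unfolding S2_def by (intro sum_nonneg) auto
    \<comment> \<open>Each hub is at least as heavy as the lower bound for hub \<open>R\<close>, so
      the deleted squares sum to at least c0^2 R^(1 - 2 \<alpha>) A^2.\<close>
    have S2_upper: "S2 \<le> (\<mu> - \<kappa> * y) * n"
    proof -
      have "\<kappa> * A\<^sup>2 \<le> c\<^sub>0\<^sup>2 * real R powr (1 - 2 * \<alpha>) * A\<^sup>2" using R by (intro mult_right_mono) auto
      also have "real R powr (1 - 2 * \<alpha>) = R * (real R powr - \<alpha>)\<^sup>2"
        using R by (simp add: powr_diff powr_minus_divide power2_eq_square flip: powr_add)
      also have "c\<^sub>0\<^sup>2 * (R * (real R powr - \<alpha>)\<^sup>2) * A\<^sup>2 = (\<Sum>j=1..R. (c\<^sub>0 * A * real R powr - \<alpha>)\<^sup>2)"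
        by (simp add: power_mult_distrib)
      also have "\<dots> \<le> (\<Sum>j=1..R. (?w j)\<^sup>2)"
        using w_lower c0 A1 by (intro sum_mono power_mono) auto
      finally have "\<kappa> * A\<^sup>2 \<le> (\<Sum>j=1..R. (?w j)\<^sup>2)" .
      then show ?thesis
        using C2(3)[OF n(1)] split[of "\<lambda>j. (?w j)\<^sup>2"] A2 by (simp add: S2_def algebra_simps)
    qed
    have S2_lower: "(\<mu> - (C2 + R * C\<^sup>2) * y) * n \<le> S2"
    proof -
      have "(\<Sum>j=1..R. (?w j)\<^sup>2) \<le> (\<Sum>j=1..R. (C * A)\<^sup>2)"
        using n by (intro sum_mono power_mono w_upper w0) auto
      also have "\<dots> = R * C\<^sup>2 * y * n" by (simp add: power_mult_distrib A2)
      finally show ?thesis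
        using C2(2)[OF n(1)] split[of "\<lambda>j. (?w j)\<^sup>2"] A2 by (simp add: S2_def A_def[symmetric] algebra_simps)
    qed
    have hub_mass: "(\<Sum>j=1..R. ?w j) \<le> S1 / 2"
    proof -
      have "(\<Sum>j=1..R. ?w j) \<le> (\<Sum>j=1..R. C * A)" using n by (intro sum_mono w_upper) auto
      also have "\<dots> = R * C * A" by simp
      also have "\<dots> \<le> R * C * A\<^sup>2" using A_sq C by (intro mult_left_mono) auto
      also have "\<dots> = R * C * y * n" by (simp add: A2)
      also have "\<dots> \<le> \<mu> / 4 * n" using y_bounds by (intro mult_right_mono) auto
      also have "\<dots> \<le> S1 / 2" using S1_half by (simp add: mult.commute)
      finally show ?thesis .
    qed
    show ?case
    proof (intro allI impI)
      fix e assume e: "\<bar>e\<bar> \<le> \<Lambda> * ((real n powr \<alpha>)\<^sup>2 / real n)"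
      then have e: "\<bar>e\<bar> \<le> \<Lambda> * y" by (simp add: y_def A_def)
      with y_bounds have e_half: "1 / 2 \<le> 1 + e" "1 + e \<le> 3 / 2" by auto
      define v where "v j = (1 + e) * ?w j" for j
      have L: "total_weight n v = (1 + e) * S1"
        by (simp add: total_weight_def v_def S1_def sum_distrib_left)
      have L0: "0 < total_weight n v" unfolding L using e_half S10 by simp
      \<comment> \<open>The factor 1 + e cancels here, so it enters the ratio of second to first
        moments only once.\<close>
      have v_over_L: "v u / total_weight n v = ?w u / S1" for u
        unfolding L v_def using e_half by simp
      have nu_eq: "(\<Sum>u\<in>?U. (v u)\<^sup>2 / total_weight n v) = (1 + e) * S2 / S1"
      proof -
        have "(v u)\<^sup>2 / total_weight n v = (1 + e) * (?w u)\<^sup>2 / S1" for u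
        proof -
          have "(v u)\<^sup>2 / total_weight n v = v u * (v u / total_weight n v)"
            by (simp add: power2_eq_square)
          then show ?thesis unfolding v_over_L by (simp add: v_def power2_eq_square)
        qed
        then show ?thesis by (simp add: S2_def sum_distrib_left sum_divide_distrib)
      qed
      have "critical_weights n v R A K c"
      proof unfold_locales
        show "0 \<le> v i" if "i \<in> {1..n}" for i using w0[OF that] e_half by (simp add: v_def)
        show "0 < total_weight n v" by (rule L0)
        show "1 \<le> A" by (rule A1)
        show "A\<^sup>2 \<le> real n" using A2 y_bounds mult_right_mono[of y 1 "real n"] by simp
        show "0 < c" "1 \<le> K" "1 \<le> R" "R \<le> n" by fact+
        show "v i \<le> K * A" if "i \<in> {1..n}" for i
        proof -
          have "v i \<le> 3 / 2 * (C * A)"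
            unfolding v_def using w0[OF that] w_upper[OF that] e_half by (intro mult_mono) auto
          also have "\<dots> \<le> K * A" using mult_right_mono[OF K(2), of A] A1 by simp
          finally show ?thesis .
        qed
        show "c * A \<le> v 1"
        proof -
          have "c * A \<le> 1 / 2 * (c\<^sub>0 * A)" using mult_right_mono[of c "c\<^sub>0 / 2" A] A1 by (simp add: c_def)
          also have "\<dots> \<le> v 1"
            unfolding v_def using w_lower'[of 1] R e_half c0 A1 by (intro mult_mono) auto
          finally show ?thesis .
        qed
        show "c * n \<le> total_weight n v"
        proof -
          have "c * n \<le> 1 / 2 * (\<mu> / 2 * n)" using mult_right_mono[of c "\<mu> / 4" "real n"] by (simp add: c_def)
          also have "\<dots> \<le> (1 + e) * S1" using e_half S1_half mu by (intro mult_mono) auto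
          finally show ?thesis by (simp add: L)
        qed
        show "total_weight n v \<le> K * n"
        proof -
          have "(1 + e) * S1 \<le> 3 / 2 * (\<mu> * n)" using e_half S1_upper S10 by (intro mult_mono) auto
          also have "\<dots> \<le> K * n" using mult_right_mono[OF K(3), of "real n"] by simp
          finally show ?thesis by (simp add: L)
        qed
        show "(\<Sum>u\<in>?U. (v u)\<^sup>2 / total_weight n v) \<le> 1 - A\<^sup>2 / n"
        proof -
          have "(1 + e) * S2 \<le> (1 + \<Lambda> * y) * ((\<mu> - \<kappa> * y) * n)"
            using e S2_upper S2_0 y0 \<Lambda> by (intro mult_mono) auto
          \<comment> \<open>By the choice of \<kappa> the linear terms in y agree, and the quadratic
            ones have the right sign.\<close>
          also have "\<dots> \<le> ((1 - y) * (\<mu> - C1 * y)) * n"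
          proof -
            have "0 \<le> \<Lambda> * \<kappa> * y\<^sup>2 + C1 * y\<^sup>2" using \<Lambda> \<kappa> C1 by simp
            then have "(1 + \<Lambda> * y) * (\<mu> - \<kappa> * y) \<le> (1 - y) * (\<mu> - C1 * y)"
              by (simp add: \<kappa>_def algebra_simps power2_eq_square)
            then show ?thesis by (simp only: mult.assoc[symmetric]) (rule mult_right_mono, auto)
          qed
          also have "\<dots> \<le> (1 - y) * S1"
            using mult_left_mono[OF S1_lower, of "1 - y"] y_bounds by (simp add: mult.assoc)
          finally show ?thesis unfolding nu_eq y_def[symmetric] using S10 by (simp add: pos_divide_le_eq)
        qed
        show "1 - K * (A\<^sup>2 / n) \<le> (\<Sum>u\<in>?U. (v u)\<^sup>2 / total_weight n v)"
        proof -
          define t where "t = (C2 + R * C\<^sup>2) / \<mu>"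
          have t: "0 \<le> t" using C2 mu by (simp add: t_def)
          have "1 - K * y \<le> 1 - (\<Lambda> + t) * y"
            using K(4) y0 by (simp add: K1_def t_def)
          also have "\<dots> \<le> (1 - \<Lambda> * y) * (1 - t * y)"
          proof -
            have "0 \<le> \<Lambda> * t * y\<^sup>2" using \<Lambda> t by simp
            then show ?thesis by (simp add: algebra_simps power2_eq_square)
          qed
          also have "1 - t * y = ((\<mu> - (C2 + R * C\<^sup>2) * y) * n) / (\<mu> * n)"
            using mu n by (simp add: t_def field_simps)
          also have "(1 - \<Lambda> * y) * \<dots> \<le> (1 - \<Lambda> * y) * (S2 / (\<mu> * n))"
            using S2_lower mu n y_bounds by (intro mult_left_mono divide_right_mono) auto
          also have "\<dots> \<le> (1 + e) * (S2 / S1)"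
            using e e_half S2_0 S1_upper S10 mu n by (intro mult_mono divide_left_mono) auto
          finally show ?thesis unfolding nu_eq y_def[symmetric] by simp
        qed
        show "1 / 2 \<le> (\<Sum>u\<in>?U. v u / total_weight n v)"
        proof -
          have "S1 / 2 \<le> (\<Sum>u\<in>?U. ?w u)" using hub_mass split[of ?w] by (simp add: S1_def)
          then have "1 / 2 \<le> (\<Sum>u\<in>?U. ?w u) / S1" using S10 by (simp add: field_simps)
          then show ?thesis by (simp add: v_over_L sum_divide_distrib)
        qed
        show "(\<Sum>u\<in>?U. v u * (v u + 1)\<^sup>2 / total_weight n v) \<le> K * (A ^ 3 / n)"
        proof -
          have "(\<Sum>u\<in>?U. v u * (v u + 1)\<^sup>2 / total_weight n v) \<le> (\<Sum>u\<in>?U. 8 * (?w u ^ 3 + ?w u) / S1)"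
          proof (rule sum_mono)
            fix u assume "u \<in> ?U"
            then have w: "0 \<le> ?w u" using w0 by auto
            have "v u \<le> 3 / 2 * ?w u" unfolding v_def using e_half w by (intro mult_right_mono) auto
            then have "(v u + 1)\<^sup>2 \<le> (2 * (?w u + 1))\<^sup>2"
              using w e_half by (intro power_mono) (auto simp: v_def)
            also have "\<dots> \<le> 8 * ((?w u)\<^sup>2 + 1)"
              using zero_le_power2[of "?w u - 1"] by (simp add: power2_eq_square algebra_simps)
            finally have "?w u / S1 * (v u + 1)\<^sup>2 \<le> ?w u / S1 * (8 * ((?w u)\<^sup>2 + 1))"
              using w S10 by (intro mult_left_mono) auto
            also have "\<dots> = 8 * (?w u ^ 3 + ?w u) / S1"
              by (simp add: power2_eq_square power3_eq_cube algebra_simps add_divide_distrib)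
            finally show "v u * (v u + 1)\<^sup>2 / total_weight n v \<le> 8 * (?w u ^ 3 + ?w u) / S1"
              by (simp flip: v_over_L)
          qed
          also have "\<dots> \<le> (\<Sum>u=1..n. 8 * (?w u ^ 3 + ?w u) / S1)"
            using w0 S10 by (intro sum_mono2) auto
          also have "\<dots> = 8 * ((\<Sum>u=1..n. ?w u ^ 3) + S1) / S1"
            by (simp add: S1_def sum.distrib flip: sum_distrib_left sum_divide_distrib)
          \<comment> \<open>The first-order sum is absorbed through n <= A^3; the denominator is
            replaced by \<mu> n / 2, which accounts for the 16 in \<open>K2\<close>.\<close>
          also have "\<dots> \<le> 8 * (C3 * A ^ 3 + \<mu> * A ^ 3) / (\<mu> / 2 * n)"
          proof (intro frac_le mult_left_mono add_mono)
            show "S1 \<le> \<mu> * A ^ 3" using order_trans[OF S1_upper mult_left_mono[OF A3]] mu by simp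
            show "(\<Sum>u=1..n. ?w u ^ 3) \<le> C3 * A ^ 3" using C3(2)[OF n(1)] by (simp add: A_def)
          qed (use mu n C3 A1 S1_half in auto)
          also have "\<dots> = K2 * (A ^ 3 / n)" using mu n by (simp add: K2_def field_simps)
          also have "\<dots> \<le> K * (A ^ 3 / n)" using K(5) A1 by (intro mult_right_mono) auto
          finally show ?thesis .
        qed
      qed
      then show "critical_weights n (\<lambda>j. (1 + e) * ?w j) R (n powr \<alpha>) K c"
        by (simp add: v_def[abs_def] A_def)
    qed
  qed
  then show ?thesis by blast
qed

end

section \<open>The largest cluster\<close>

theorem theorem1p2:
  fixes M :: "'a measure" and W :: "'a \<Rightarrow> real" and F :: "real \<Rightarrow> real"
    and \<tau> c\<^sub>F \<Lambda> :: real
  assumes "prob_space M"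
    and "W \<in> borel_measurable M"
    and "AE x in M. 0 \<le> W x"
    and "F = cdf (distr M borel W)"
    and "prob_space.expectation M (\<lambda>x. (W x)\<^sup>2) / prob_space.expectation M W = 1"
    and "3 < \<tau>" and "\<tau> < 4"
    and "0 < c\<^sub>F"
    and "((\<lambda>x. x powr (\<tau> - 1) * (1 - F x)) \<longlongrightarrow> c\<^sub>F) at_top"
    and "0 < \<Lambda>"
  shows "\<exists>b>0. \<forall>\<epsilon> :: nat \<Rightarrow> real.
           (\<forall>n\<ge>1. \<bar>\<epsilon> n\<bar> \<le> \<Lambda> * real n powr (- (\<tau> - 3) / (\<tau> - 1))) \<longrightarrow>
           (\<forall>\<omega>>1. \<forall>\<^sub>F n in sequentially.
              measure_pmf.prob (NR n (\<lambda>j. (1 + \<epsilon> n) * weight F n j))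
                {E. inverse \<omega> * real n powr ((\<tau> - 2) / (\<tau> - 1)) \<le> real (max_cluster_size n E) \<and>
                    real (max_cluster_size n E) \<le> \<omega> * real n powr ((\<tau> - 2) / (\<tau> - 1))}
              \<ge> 1 - b / \<omega>)"
proof -
  interpret heavy_tailed M W F \<tau> c\<^sub>F
    by (rule heavy_tailed.intro; fact assms)
  define y where "y n = (real n powr \<alpha>)\<^sup>2 / real n" for n
  obtain R K c where ev: "\<forall>\<^sub>F n in sequentially. \<forall>e. \<bar>e\<bar> \<le> \<Lambda> * y n \<longrightarrow>
      critical_weights n (\<lambda>j. (1 + e) * weight F n j) R (n powr \<alpha>) K c"
    using critical_weights_eventually[OF \<open>0 < \<Lambda>\<close>] unfolding y_def by blast
  \<comment> \<open>The locale constants are repeated outside the locale, so that \<open>b\<close>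
    is fixed before \<epsilon>, \<omega> and n.\<close>
  define D where "D = 2 * (K + 1 + K\<^sup>2 / (2 * c))"
  define \<eta> where "\<eta> = c / (2 * D)"
  define b where "b = (real R + 1) * (K + 1) + (exp (2 * D) * (8 / c\<^sup>2) + K\<^sup>2 / (c * \<eta>))"
  have expo: "- (\<tau> - 3) / (\<tau> - 1) = 2 * \<alpha> - 1" "(\<tau> - 2) / (\<tau> - 1) = 1 - \<alpha>"
    using tau by (auto simp: \<alpha>_def field_simps)
  have powr_y: "real n powr (2 * \<alpha> - 1) = y n" if "1 \<le> n" for n
    using that by (simp add: y_def powr_diff powr_powr mult.commute flip: powr_realpow)
  have powr_A: "real n powr (1 - \<alpha>) = real n / real n powr \<alpha>" if "1 \<le> n" for n
    using that by (simp add: powr_diff)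
  \<comment> \<open>One instance with e = 0 suffices to read off the signs of \<open>c\<close> and
    \<open>K\<close> from the locale assumptions.\<close>
  obtain n\<^sub>0 where "\<forall>e. \<bar>e\<bar> \<le> \<Lambda> * y n\<^sub>0 \<longrightarrow>
      critical_weights n\<^sub>0 (\<lambda>j. (1 + e) * weight F n\<^sub>0 j) R (real n\<^sub>0 powr \<alpha>) K c"
    using eventually_happens'[OF sequentially_bot ev] by blast
  moreover have "0 \<le> \<Lambda> * y n\<^sub>0" using \<open>0 < \<Lambda>\<close> by (simp add: y_def)
  ultimately have "critical_weights n\<^sub>0 (\<lambda>j. (1 + 0) * weight F n\<^sub>0 j) R (real n\<^sub>0 powr \<alpha>) K c"
    by (metis abs_zero)
  then have "0 < c" "1 \<le> K"
    by (simp_all add: critical_weights_def critical_weights_axioms_def)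
  then have "0 < D" and "0 < \<eta>" by (auto simp: D_def \<eta>_def intro!: divide_pos_pos add_pos_nonneg)
  have "0 < (real R + 1) * (K + 1)"
    using \<open>1 \<le> K\<close> by (intro mult_pos_pos) auto
  then have "0 < b"
    unfolding b_def using \<open>0 < c\<close> \<open>0 < \<eta>\<close> by (intro add_pos_nonneg) auto
  moreover have "\<forall>\<^sub>F n in sequentially.
      measure_pmf.prob (NR n (\<lambda>j. (1 + \<epsilon> n) * weight F n j))
        {E. inverse \<omega> * real n powr ((\<tau> - 2) / (\<tau> - 1)) \<le> real (max_cluster_size n E) \<and>
            real (max_cluster_size n E) \<le> \<omega> * real n powr ((\<tau> - 2) / (\<tau> - 1))} \<ge> 1 - b / \<omega>"
    if \<epsilon>: "\<forall>n\<ge>1. \<bar>\<epsilon> n\<bar> \<le> \<Lambda> * real n powr (- (\<tau> - 3) / (\<tau> - 1))" and \<omega>: "1 < \<omega>"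
    for \<epsilon> :: "nat \<Rightarrow> real" and \<omega> :: real
  proof -
    \<comment> \<open>For fixed \<omega> the shift \<delta> is a constant times the window width, so
      it is eventually below 1; this is where the threshold for n depends on \<omega>.\<close>
    have "(\<lambda>n. D * (1 + \<eta> * \<omega> + sqrt \<omega>) * y n) \<longlonglongrightarrow> D * (1 + \<eta> * \<omega> + sqrt \<omega>) * 0"
      using window_tendsto_0 unfolding y_def by (rule tendsto_mult_left)
    then have "\<forall>\<^sub>F n in sequentially. D * (1 + \<eta> * \<omega> + sqrt \<omega>) * y n < 1"
      by (rule order_tendstoD) simp
    with ev eventually_ge_at_top[of 1] show ?thesis
    proof eventually_elim
      case (elim n)
      let ?v = "\<lambda>j. (1 + \<epsilon> n) * weight F n j"
      have "\<bar>\<epsilon> n\<bar> \<le> \<Lambda> * y n"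
        using \<epsilon>[rule_format, OF elim(2)] unfolding expo powr_y[OF elim(2)] .
      then interpret cw: critical_weights n ?v R "real n powr \<alpha>" K c
        using elim(1) by blast
      have cw_D: "cw.D = D" and cw_\<eta>: "cw.\<eta> = \<eta>"
        by (simp_all add: cw.D_def cw.\<eta>_def D_def \<eta>_def)
      have up: "measure_pmf.prob (NR n ?v) {E. \<omega> * (n / n powr \<alpha>) < real (max_cluster_size n E)} \<le>
          (real R + 1) * (K + 1) / \<omega>"
        by (rule cw.upper_tail[OF \<omega>])
      have "cw.\<delta> \<omega> \<le> 1"
        using elim(3) by (simp add: cw.\<delta>_def cw_D cw_\<eta> y_def)
      then have low: "measure_pmf.prob (NR n ?v) {E. real (max_cluster_size n E) < n / n powr \<alpha> / \<omega>} \<le>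
          (exp (2 * D) * (8 / c\<^sup>2) + K\<^sup>2 / (c * \<eta>)) / \<omega>"
        using cw.lower_tail[OF \<omega>] by (simp add: cw_D cw_\<eta>)
      let ?good = "{E. inverse \<omega> * real n powr ((\<tau> - 2) / (\<tau> - 1)) \<le> real (max_cluster_size n E) \<and>
            real (max_cluster_size n E) \<le> \<omega> * real n powr ((\<tau> - 2) / (\<tau> - 1))}"
      let ?big = "{E. \<omega> * (n / n powr \<alpha>) < real (max_cluster_size n E)}"
      let ?small = "{E. real (max_cluster_size n E) < n / n powr \<alpha> / \<omega>}"
      have "1 = measure_pmf.prob (NR n ?v) (?good \<union> (?big \<union> ?small))"
      proof -
        have "?good \<union> (?big \<union> ?small) = UNIV"
          unfolding expo(2) powr_A[OF elim(2)] by (auto simp: divide_inverse mult.commute not_le not_less)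
        then show ?thesis by simp
      qed
      also have "\<dots> \<le> measure_pmf.prob (NR n ?v) ?good +
          (measure_pmf.prob (NR n ?v) ?big + measure_pmf.prob (NR n ?v) ?small)"
        by (intro order_trans[OF measure_Un_le] add_left_mono measure_Un_le) auto
      also have "\<dots> \<le> measure_pmf.prob (NR n ?v) ?good + b / \<omega>"
        using up low by (simp add: b_def add_divide_distrib)
      finally show ?case by simp
    qed
  qed
  ultimately show ?thesis by blast
qed

end
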